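(* Let $n$ be a positive integer. The symmetric Jordan basis $O(n)$ of $V(B(n))$ produced by the linear BTK algorithm applied to the Boolean algebra $B(n)$ is the symmetric Gelfand-Tsetlin basis of $V(B(n))$ (which is canonically defined up to scalars); that is, $O(n)$ is a symmetric Jordan basis such that, for every $0\le k\le n$, the elements of $O(n)$ of rank $k$ form the Gelfand-Tsetlin basis (up to scaling of individual vectors) of the $S_n$-module $V(B(n)_k)$.
   Context: Posets. $M(n,k_1,\ldots,k_n)=\{(x_1,\ldots,x_n)\in\mathbb{N}^n : 0\le x_i\le k_i \text{ for all } i\}$ (with $0\in\mathbb{N}$), partially ordered componentwise, with rank function $r(x_1,\ldots,x_n)=x_1+\cdots+x_n$. The Boolean algebra is $B(n)=M(n,1,\ldots,1)$ (equivalently, subsets of $\{1,\ldots,n\}$ under inclusion), of rank $n$; $B(n)_k$ is the set of elements of rank $k$. For a finite set $S$, $V(S)$ is the complex vector space with basis $S$. For a graded poset $P$, $v\in V(P)$ is homogeneous of rank $r(v)=i$ if $v\in V(P_i)$, where $P_i$ is the set of elements of rank $i$. The up operator $U:V(P)\to V(P)$ is the linear map with $U(p)=\sum_q q$, the sum over all $q$ covering $p$. Jordan chains. A symmetric Jordan chain is a sequence $(v_1,\ldots,v_h)$ of nonzero homogeneous vectors of $V(P)$ with $U(v_{i-1})=v_i$ for $2\le i\le h$, $U(v_h)=0$, and $r(v_1)+r(v_h)$ equal to the rank of $P$. A symmetric Jordan basis (SJB) is a basis of $V(P)$ that is a disjoint union of symmetric Jordan chains. Gelfand-Tsetlin bases.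 All representations are finite dimensional and complex. $S_1\subseteq S_2\subseteq\cdots\subseteq S_n$, where $S_{i}$ is the subgroup of $S_n$ fixing $i+1,\ldots,n$. The restriction of an irreducible $S_i$-module to $S_{i-1}$ is multiplicity free, so an irreducible $S_n$-module $V$ decomposes canonically into irreducible $S_{n-1}$-modules, each of these canonically into irreducible $S_{n-2}$-modules, and so on down to $S_1$, giving a canonical decomposition of $V$ into one-dimensional subspaces. Choosing a nonzero vector from each of them gives the Gelfand-Tsetlin basis (GZ-basis) of $V$, determined up to scalars. For a multiplicity-free $S_n$-module, the GZ-basis is the union of the GZ-bases of the irreducible submodules in its canonical decomposition. The group $S_n$ acts on $B(n)$ by substitution (permuting $\{1,\ldots,n\}$, hence its subsets), and each $V(B(n)_k)$ is a multiplicity-free $S_n$-module. The symmetric Gelfand-Tsetlin basis of $V(B(n))$ is the (canonically defined up to scalars) SJB of $V(B(n))$ that is the union of the GZ-bases of $V(B(n)_k)$, $0\le k\le n$. The linear BTK algorithm. Step A (two factors). For integers $p,q\ge 0$ define recursively a collection $\mathcal{J}(p,q)$ of sequences of vectors of $V(M(2,p,q))$. If $p=0$ or $q=0$, then $\mathcal{J}(p,q)$ consists of the single sequence listing the elements of the chain $M(2,p,q)$ in increasing order. If $p,q\ge 1$, then $\mathcal{J}(p,q)$ consists of: (1) the sequence $(v(0),v(1),\ldots,v(p+q))$, where $v(k)=\sum\binom{k}{i}(i,j)$, the sum over all $0\le i\le p$, $0\le j\le q$ with $i+j=k$; and (2) for each sequence $(w_1,\ldots,w_h)$ in $\mathcal{J}(p-1,q-1)$,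 the sequence $(\theta(w_1),\ldots,\theta(w_h))$, where $\theta:V(M(2,p-1,q-1))\to V(M(2,p,q))$ is the linear map with $\theta((i,j))=v(i,j+1)$, and $v(i,j)=(p-i)\,(i,j)-(q-j+1)\,(i+1,j-1)$ for $0\le i\le p-1$, $1\le j\le q$. Step B (general case, recursion on $n$). For $n=1$, $\mathcal{L}(k_1)$ consists of the single sequence $(0,1,\ldots,k_1)$ of elements of $M(1,k_1)$. For $n\ge 2$, let the sequences in $\mathcal{L}(k_1,\ldots,k_{n-1})$ be $(v(0,m),\ldots,v(l_m,m))$, $1\le m\le t$. For $0\le j\le k_n$ let $v(i,j,m)\in V(M(n,k_1,\ldots,k_n))$ be the image of $v(i,m)$ under the linear map with $(a_1,\ldots,a_{n-1})\mapsto(a_1,\ldots,a_{n-1},j)$. For each $m$ let $\psi_m:V(M(2,l_m,k_n))\to V(M(n,k_1,\ldots,k_n))$ be the linear map with $\psi_m((i,j))=v(i,j,m)$. Then $\mathcal{L}(k_1,\ldots,k_n)$ consists of all sequences $(\psi_m(w_1),\ldots,\psi_m(w_h))$ with $1\le m\le t$ and $(w_1,\ldots,w_h)\in\mathcal{J}(l_m,k_n)$. The sequences in $\mathcal{L}(k_1,\ldots,k_n)$ together form an SJB of $V(M(n,k_1,\ldots,k_n))$. $O(n)$ denotes this SJB in the case $k_1=\cdots=k_n=1$. *)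

theory Defs
  imports Complex_Main "HOL-Library.Poly_Mapping" "HOL-Combinatorics.Permutations"
begin

section \<open>Complex vector spaces with a given basis\<close>

text \<open>
  All vector spaces are subspaces of the free complex vector space on a type, i.e. of the type
  of finitely supported functions. vspace S is the one with basis S.
\<close>

definition scale :: "complex \<Rightarrow> ('a \<Rightarrow>\<^sub>0 complex) \<Rightarrow> ('a \<Rightarrow>\<^sub>0 complex)" where
  "scale c v = Poly_Mapping.map ((*) c) v"

lemma lookup_scale: "Poly_Mapping.lookup (scale c v) x = c * Poly_Mapping.lookup v x"
  by (simp add: scale_def map.rep_eq when_def)

interpretation VS: vector_space "scale :: complex \<Rightarrow> ('a \<Rightarrow>\<^sub>0 complex) \<Rightarrow> _"
  by unfold_locales (auto intro!: poly_mapping_eqI simp: lookup_scale lookup_add algebra_simps)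

definition vspace :: "'a set \<Rightarrow> ('a \<Rightarrow>\<^sub>0 complex) set" where
  "vspace S = {v. Poly_Mapping.keys v \<subseteq> S}"

definition bvec :: "'a \<Rightarrow> ('a \<Rightarrow>\<^sub>0 complex)" where
  "bvec x = Poly_Mapping.single x 1"

text \<open>The linear map that sends each basis element x to f x.\<close>

definition lin :: "('a \<Rightarrow> ('b \<Rightarrow>\<^sub>0 complex)) \<Rightarrow> ('a \<Rightarrow>\<^sub>0 complex) \<Rightarrow> ('b \<Rightarrow>\<^sub>0 complex)" where
  "lin f v = (\<Sum>x\<in>Poly_Mapping.keys v. scale (Poly_Mapping.lookup v x) (f x))"


section \<open>Graded posets and symmetric Jordan bases\<close>

text \<open>A finite graded poset is given by its carrier P, its order le and its rank function rk.\<close>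

definition covers :: "'a set \<Rightarrow> ('a \<Rightarrow> 'a \<Rightarrow> bool) \<Rightarrow> 'a \<Rightarrow> 'a \<Rightarrow> bool" where
  "covers P le x y \<longleftrightarrow> x \<in> P \<and> y \<in> P \<and> le x y \<and> x \<noteq> y \<and>
     (\<forall>z\<in>P. le x z \<and> le z y \<longrightarrow> z = x \<or> z = y)"

definition up :: "'a set \<Rightarrow> ('a \<Rightarrow> 'a \<Rightarrow> bool) \<Rightarrow> ('a \<Rightarrow>\<^sub>0 complex) \<Rightarrow> ('a \<Rightarrow>\<^sub>0 complex)" where
  "up P le = lin (\<lambda>x. \<Sum>y\<in>{y. covers P le x y}. bvec y)"

definition level :: "'a set \<Rightarrow> ('a \<Rightarrow> nat) \<Rightarrow> nat \<Rightarrow> 'a set" where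
  "level P rk i = {x\<in>P. rk x = i}"

definition poset_rank :: "'a set \<Rightarrow> ('a \<Rightarrow> nat) \<Rightarrow> nat" where
  "poset_rank P rk = Max (rk ` P)"

definition symmetric_jordan_chain ::
  "'a set \<Rightarrow> ('a \<Rightarrow> 'a \<Rightarrow> bool) \<Rightarrow> ('a \<Rightarrow> nat) \<Rightarrow> ('a \<Rightarrow>\<^sub>0 complex) list \<Rightarrow> bool" where
  "symmetric_jordan_chain P le rk vs \<longleftrightarrow>
     vs \<noteq> [] \<and>
     (\<forall>v\<in>set vs. v \<noteq> 0 \<and> (\<exists>i. v \<in> vspace (level P rk i))) \<and>
     (\<forall>i. Suc i < length vs \<longrightarrow> up P le (vs ! i) = vs ! Suc i) \<and>
     up P le (last vs) = 0 \<and>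
     (\<exists>a b. hd vs \<in> vspace (level P rk a) \<and> last vs \<in> vspace (level P rk b) \<and> a + b = poset_rank P rk)"

text \<open>The basis is given together with its chains; distinctness makes their union disjoint.\<close>

definition symmetric_jordan_basis ::
  "'a set \<Rightarrow> ('a \<Rightarrow> 'a \<Rightarrow> bool) \<Rightarrow> ('a \<Rightarrow> nat) \<Rightarrow> ('a \<Rightarrow>\<^sub>0 complex) list list \<Rightarrow> bool" where
  "symmetric_jordan_basis P le rk cs \<longleftrightarrow>
     (\<forall>vs\<in>set cs. symmetric_jordan_chain P le rk vs) \<and>
     distinct (concat cs) \<and>
     VS.independent (set (concat cs)) \<and>
     VS.span (set (concat cs)) = vspace P"


section \<open>Products of chains\<close>

text \<open>Tuples are lists; the rank function is sum_list.\<close>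

definition tuple_le :: "nat list \<Rightarrow> nat list \<Rightarrow> bool" where
  "tuple_le x y \<longleftrightarrow> list_all2 (\<le>) x y"

definition chain_product :: "nat list \<Rightarrow> nat list set" where
  "chain_product ks = {x. length x = length ks \<and> (\<forall>i<length ks. x ! i \<le> ks ! i)}"

definition Bool_alg :: "nat \<Rightarrow> nat list set" where
  "Bool_alg n = chain_product (replicate n 1)"


section \<open>The linear BTK algorithm\<close>

definition vsum :: "nat \<Rightarrow> nat \<Rightarrow> nat \<Rightarrow> (nat list \<Rightarrow>\<^sub>0 complex)" where
  "vsum p q k = (\<Sum>(i, j)\<in>{(i, j). i \<le> p \<and> j \<le> q \<and> i + j = k}.
                   scale (of_nat (k choose i)) (bvec [i, j]))"

definition vdiff :: "nat \<Rightarrow> nat \<Rightarrow> nat \<Rightarrow> nat \<Rightarrow> (nat list \<Rightarrow>\<^sub>0 complex)" where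
  "vdiff p q i j = scale (of_nat p - of_nat i) (bvec [i, j])
                 - scale (of_nat q - of_nat j + 1) (bvec [i + 1, j - 1])"

definition theta :: "nat \<Rightarrow> nat \<Rightarrow> (nat list \<Rightarrow>\<^sub>0 complex) \<Rightarrow> (nat list \<Rightarrow>\<^sub>0 complex)" where
  "theta p q = lin (\<lambda>x. vdiff p q (x ! 0) (x ! 1 + 1))"

fun btk2 :: "nat \<Rightarrow> nat \<Rightarrow> (nat list \<Rightarrow>\<^sub>0 complex) list list" where
  "btk2 0 q = [map (\<lambda>j. bvec [0, j]) [0..<q + 1]]"
| "btk2 (Suc p) 0 = [map (\<lambda>i. bvec [i, 0]) [0..<Suc p + 1]]"
| "btk2 (Suc p) (Suc q) =
     map (vsum (Suc p) (Suc q)) [0..<Suc p + Suc q + 1]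
     # map (map (theta (Suc p) (Suc q))) (btk2 p q)"

definition append_coord :: "nat \<Rightarrow> (nat list \<Rightarrow>\<^sub>0 complex) \<Rightarrow> (nat list \<Rightarrow>\<^sub>0 complex)" where
  "append_coord j = lin (\<lambda>a. bvec (a @ [j]))"

definition psi :: "(nat list \<Rightarrow>\<^sub>0 complex) list \<Rightarrow> (nat list \<Rightarrow>\<^sub>0 complex) \<Rightarrow> (nat list \<Rightarrow>\<^sub>0 complex)" where
  "psi vs = lin (\<lambda>x. append_coord (x ! 1) (vs ! (x ! 0)))"

text \<open>The recursion splits off the last entry. The value at the empty list is a dummy.\<close>

fun btk :: "nat list \<Rightarrow> (nat list \<Rightarrow>\<^sub>0 complex) list list" where
  "btk [] = []"
| "btk [k] = [map (\<lambda>i. bvec [i]) [0..<k + 1]]"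
| "btk (k # k' # ks) =
     concat (map (\<lambda>vs. map (map (psi vs)) (btk2 (length vs - 1) (last (k' # ks))))
                 (btk (butlast (k # k' # ks))))"

definition btk_Bool_alg :: "nat \<Rightarrow> (nat list \<Rightarrow>\<^sub>0 complex) list list" where
  "btk_Bool_alg n = btk (replicate n 1)"


section \<open>Gelfand-Tsetlin bases\<close>

text \<open>
  Symmetric groups act on positions of lists, which are numbered from 0. A group G of
  permutations acts on vectors through rho; its modules are the invariant subspaces.
\<close>

definition Sym :: "nat \<Rightarrow> (nat \<Rightarrow> nat) set" where
  "Sym i = {\<sigma>. \<sigma> permutes {..<i}}"

definition submodule ::
  "((nat \<Rightarrow> nat) \<Rightarrow> ('a \<Rightarrow>\<^sub>0 complex) \<Rightarrow> ('a \<Rightarrow>\<^sub>0 complex)) \<Rightarrow> (nat \<Rightarrow> nat) set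
     \<Rightarrow> ('a \<Rightarrow>\<^sub>0 complex) set \<Rightarrow> bool" where
  "submodule rho G W \<longleftrightarrow> VS.subspace W \<and> (\<forall>\<sigma>\<in>G. \<forall>w\<in>W. rho \<sigma> w \<in> W)"

definition irreducible_module ::
  "((nat \<Rightarrow> nat) \<Rightarrow> ('a \<Rightarrow>\<^sub>0 complex) \<Rightarrow> ('a \<Rightarrow>\<^sub>0 complex)) \<Rightarrow> (nat \<Rightarrow> nat) set
     \<Rightarrow> ('a \<Rightarrow>\<^sub>0 complex) set \<Rightarrow> bool" where
  "irreducible_module rho G W \<longleftrightarrow>
     submodule rho G W \<and> W \<noteq> {0} \<and>
     (\<forall>X. submodule rho G X \<and> X \<subseteq> W \<longrightarrow> X = {0} \<or> X = W)"

definition isomorphic_modules ::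
  "((nat \<Rightarrow> nat) \<Rightarrow> ('a \<Rightarrow>\<^sub>0 complex) \<Rightarrow> ('a \<Rightarrow>\<^sub>0 complex)) \<Rightarrow> (nat \<Rightarrow> nat) set
     \<Rightarrow> ('a \<Rightarrow>\<^sub>0 complex) set \<Rightarrow> ('a \<Rightarrow>\<^sub>0 complex) set \<Rightarrow> bool" where
  "isomorphic_modules rho G W X \<longleftrightarrow>
     (\<exists>f. bij_betw f W X \<and>
          (\<forall>v\<in>W. \<forall>w\<in>W. f (v + w) = f v + f w) \<and>
          (\<forall>c. \<forall>w\<in>W. f (scale c w) = scale c (f w)) \<and>
          (\<forall>\<sigma>\<in>G. \<forall>w\<in>W. f (rho \<sigma> w) = rho \<sigma> (f w)))"

definition internal_direct_sum :: "('a \<Rightarrow>\<^sub>0 complex) set \<Rightarrow> ('a \<Rightarrow>\<^sub>0 complex) set set \<Rightarrow> bool" where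
  "internal_direct_sum W D \<longleftrightarrow>
     VS.span (\<Union>D) = W \<and> (\<forall>X\<in>D. X \<inter> VS.span (\<Union>(D - {X})) = {0})"

text \<open>
  W is multiplicity free as a G-module and D is the set of its irreducible summands, which is
  unique because the summands are pairwise non-isomorphic.
\<close>

definition canonical_decomposition ::
  "((nat \<Rightarrow> nat) \<Rightarrow> ('a \<Rightarrow>\<^sub>0 complex) \<Rightarrow> ('a \<Rightarrow>\<^sub>0 complex)) \<Rightarrow> (nat \<Rightarrow> nat) set
     \<Rightarrow> ('a \<Rightarrow>\<^sub>0 complex) set \<Rightarrow> ('a \<Rightarrow>\<^sub>0 complex) set set \<Rightarrow> bool" where
  "canonical_decomposition rho G W D \<longleftrightarrow>
     (\<forall>X\<in>D. irreducible_module rho G X) \<and>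
     internal_direct_sum W D \<and>
     (\<forall>X\<in>D. \<forall>Y\<in>D. X \<noteq> Y \<longrightarrow> \<not> isomorphic_modules rho G X Y)"

text \<open>
  L is the set of subspaces obtained from W by decomposing it canonically over Sym i, then
  each summand over Sym (i - 1), and so on down to Sym 1. Over the trivial group Sym 1 the
  irreducible summands are lines. The case 0 only ends the recursion.
\<close>

primrec gz_decomposition ::
  "((nat \<Rightarrow> nat) \<Rightarrow> ('a \<Rightarrow>\<^sub>0 complex) \<Rightarrow> ('a \<Rightarrow>\<^sub>0 complex)) \<Rightarrow> nat
     \<Rightarrow> ('a \<Rightarrow>\<^sub>0 complex) set \<Rightarrow> ('a \<Rightarrow>\<^sub>0 complex) set set \<Rightarrow> bool" where
  "gz_decomposition rho 0 W L \<longleftrightarrow> L = {W}"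
| "gz_decomposition rho (Suc i) W L \<longleftrightarrow>
     (\<exists>D f. canonical_decomposition rho (Sym (Suc i)) W D \<and>
            (\<forall>X\<in>D. gz_decomposition rho i X (f X)) \<and> L = (\<Union>X\<in>D. f X))"

definition gz_basis ::
  "((nat \<Rightarrow> nat) \<Rightarrow> ('a \<Rightarrow>\<^sub>0 complex) \<Rightarrow> ('a \<Rightarrow>\<^sub>0 complex)) \<Rightarrow> nat
     \<Rightarrow> ('a \<Rightarrow>\<^sub>0 complex) set \<Rightarrow> ('a \<Rightarrow>\<^sub>0 complex) set \<Rightarrow> bool" where
  "gz_basis rho n W B \<longleftrightarrow>
     (\<exists>L b. gz_decomposition rho n W L \<and> (\<forall>X\<in>L. b X \<in> X \<and> b X \<noteq> 0) \<and> B = b ` L)"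

text \<open>
  The substitution action: entry i of x moves to position \<open>\<sigma> i\<close>. As \<open>permute_list\<close> reads
  entry \<open>\<sigma> i\<close> into position i, the inverse is needed.
\<close>

definition subst_action :: "(nat \<Rightarrow> nat) \<Rightarrow> (nat list \<Rightarrow>\<^sub>0 complex) \<Rightarrow> (nat list \<Rightarrow>\<^sub>0 complex)" where
  "subst_action \<sigma> = lin (\<lambda>x. bvec (permute_list (inv \<sigma>) x))"

end

theory Submission
  imports Defs
begin

text \<open>
  Every vector of O(n) is a joint eigenvector of the sums of all transpositions in
  \<open>S\<^sub>1, \<dots>, S\<^sub>n\<close>: appending a coordinate commutes with \<open>S\<^sub>m\<close> for smaller m, and the effect of the
  transpositions that involve the new coordinate is expressed by the up and down operators, whose
  values on a symmetric Jordan chain are known. The eigenvalue for \<open>S\<^sub>m\<close> determines the rank r at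
  which the ancestor of the chain in O(m) starts, and these ranks for all m together with the rank
  of the vector determine the vector.

  Conversely, any such joint eigenbasis is a Gelfand-Tsetlin basis. The span W of the vectors with
  prescribed eigenvalues for \<open>S\<^sub>m, \<dots>, S\<^sub>n\<close> is a joint eigenspace, hence invariant under \<open>S\<^sub>m\<close>, and
  distinct eigenvalues rule out isomorphisms. W is irreducible by induction on m: an \<open>S\<^sub>m\<close>-submodule
  is a sum of some of the at most two eigenspaces for the group one step below, and if it were one
  of two, the rows of the sum of transpositions would all act by the same scalar, which contradicts the
  eigenvalues. That O(n) is a basis follows from a count, as it spans and has at most \<open>2\<^sup>n\<close> elements.
\<close>

section \<open>Linear maps between free vector spaces\<close>

interpretation VSP: module_pair
  "scale :: complex \<Rightarrow> ('a \<Rightarrow>\<^sub>0 complex) \<Rightarrow> _" "scale :: complex \<Rightarrow> ('b \<Rightarrow>\<^sub>0 complex) \<Rightarrow> _"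
  by unfold_locales

abbreviation linear_op :: "(('a \<Rightarrow>\<^sub>0 complex) \<Rightarrow> ('b \<Rightarrow>\<^sub>0 complex)) \<Rightarrow> bool" where
  "linear_op \<equiv> module_hom scale scale"

lemma linear_opI:
  assumes "\<And>v w. f (v + w) = f v + f w" "\<And>c v. f (scale c v) = scale c (f v)"
  shows "linear_op f"
  using assms by unfold_locales auto

lemma linear_op_scale: "linear_op (scale c)"
  by (rule linear_opI) (simp_all add: VS.scale_right_distrib VS.scale_left_commute)

text \<open>A common finite index set for different vectors replaces their individual supports, so
  that sums can be added term by term.\<close>

lemma lin_superset:
  assumes "finite A" "Poly_Mapping.keys v \<subseteq> A"
  shows "lin f v = (\<Sum>x\<in>A. scale (Poly_Mapping.lookup v x) (f x))"
  unfolding lin_def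
  by (rule sum.mono_neutral_left) (use assms in \<open>auto simp: in_keys_iff\<close>)

lemma linear_op_lin: "linear_op (lin f)"
proof (rule linear_opI)
  fix v w :: "'a \<Rightarrow>\<^sub>0 complex" and c
  let ?A = "Poly_Mapping.keys v \<union> Poly_Mapping.keys w"
  show "lin f (v + w) = lin f v + lin f w"
    using keys_add[of v w]
    by (simp add: lin_superset[of ?A] lookup_add VS.scale_left_distrib sum.distrib)
  have "Poly_Mapping.keys (scale c v) \<subseteq> Poly_Mapping.keys v"
    by (auto simp: in_keys_iff lookup_scale)
  then show "lin f (scale c v) = scale c (lin f v)"
    by (simp add: lin_superset[of "Poly_Mapping.keys v"] lookup_scale VS.scale_sum_right)
qed

lemmas lin_add = module_hom.add[OF linear_op_lin]
  and lin_scale = module_hom.scale[OF linear_op_lin]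
  and lin_zero = module_hom.zero[OF linear_op_lin]
  and lin_diff = module_hom.diff[OF linear_op_lin]

lemma lin_bvec [simp]: "lin f (bvec x) = f x"
  by (simp add: lin_superset[of "{x}"] bvec_def)

lemma lookup_bvec: "Poly_Mapping.lookup (bvec x) y = (if x = y then 1 else 0)"
  by (simp add: bvec_def lookup_single)

lemma vspace_eq_span: "vspace S = VS.span (bvec ` S)"
proof
  show "vspace S \<subseteq> VS.span (bvec ` S)"
  proof
    fix v :: "'a \<Rightarrow>\<^sub>0 complex" assume v: "v \<in> vspace S"
    have "v = lin bvec v"
    proof (rule poly_mapping_eqI)
      fix x show "Poly_Mapping.lookup v x = Poly_Mapping.lookup (lin bvec v) x"
        by (simp add: lin_def lookup_sum lookup_scale lookup_bvec sum.delta in_keys_iff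
            if_distrib cong: if_cong)
    qed
    also have "lin bvec v \<in> VS.span (bvec ` S)"
      using v unfolding lin_def vspace_def
      by (auto intro!: VS.span_sum VS.span_scale intro: VS.span_base)
    finally show "v \<in> VS.span (bvec ` S)" .
  qed
  have "VS.subspace (vspace S)"
    by (rule VS.subspaceI)
      (auto simp: vspace_def in_keys_iff lookup_add lookup_scale subset_iff, metis add_0)
  then show "VS.span (bvec ` S) \<subseteq> vspace S"
    by (intro VS.span_minimal) (auto simp: vspace_def bvec_def)
qed

lemma subspace_vspace: "VS.subspace (vspace S)"
  by (simp add: vspace_eq_span)

lemma bvec_in_vspace [simp]: "bvec x \<in> vspace S \<longleftrightarrow> x \<in> S"
  by (simp add: vspace_def bvec_def)

lemma vspace_mono: "S \<subseteq> T \<Longrightarrow> vspace S \<subseteq> vspace T"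
  by (auto simp: vspace_def)

lemmas vspace_add = VS.subspace_add[OF subspace_vspace]
  and vspace_scale = VS.subspace_scale[OF subspace_vspace]
  and vspace_diff = VS.subspace_diff[OF subspace_vspace]
  and vspace_sum = VS.subspace_sum[OF subspace_vspace]
  and vspace_zero = VS.subspace_0[OF subspace_vspace]

text \<open>Reduces operator identities to a check on single tuples \<open>bvec x\<close>.\<close>

lemma linear_op_eq_on_vspace:
  assumes "linear_op f" "linear_op g" "\<And>x. x \<in> S \<Longrightarrow> f (bvec x) = g (bvec x)" "v \<in> vspace S"
  shows "f v = g v"
  using VSP.module_hom_eq_on_span[of f g "bvec ` S" v] assms
  by (auto simp: vspace_eq_span)

lemma linear_op_vspace_mem:
  assumes "linear_op f" "\<And>x. x \<in> S \<Longrightarrow> f (bvec x) \<in> W" "VS.subspace W" "v \<in> vspace S"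
  shows "f v \<in> W"
proof -
  have "f ` VS.span (bvec ` S) = VS.span (f ` bvec ` S)"
    using module_hom.span_image[OF assms(1)] by simp
  also have "\<dots> \<subseteq> W"
    using assms by (intro VS.span_minimal) auto
  finally show ?thesis using assms(4) by (auto simp: vspace_eq_span)
qed

lemma independent_bvec: "VS.independent (bvec ` S)"
proof
  assume "VS.dependent (bvec ` S)"
  then obtain x where x: "x \<in> S" "bvec x \<in> VS.span (bvec ` S - {bvec x})"
    by (auto simp: VS.dependent_def)
  have "bvec ` S - {bvec x} \<subseteq> bvec ` (S - {x})" by auto
  then have "bvec x \<in> vspace (S - {x})"
    using x VS.span_mono unfolding vspace_eq_span by blast
  then show False by simp
qed

lemma inj_bvec: "inj bvec"
proof (rule injI)
  fix x y :: 'a assume "bvec x = bvec y"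
  then have "Poly_Mapping.lookup (bvec x) x = Poly_Mapping.lookup (bvec y) x" by simp
  then show "x = y" by (auto simp: lookup_bvec split: if_splits)
qed

section \<open>Moving one coordinate\<close>

lemma mem_Bool_alg: "x \<in> Bool_alg n \<longleftrightarrow> length x = n \<and> (\<forall>i<n. x ! i \<le> 1)"
  by (auto simp: Bool_alg_def chain_product_def)

lemma Bool_alg_alt: "Bool_alg n = {x. set x \<subseteq> {0, 1} \<and> length x = n}"
proof -
  have "(\<forall>i<length x. x ! i \<le> 1) \<longleftrightarrow> set x \<subseteq> {0, 1}" for x :: "nat list"
    unfolding all_set_conv_all_nth[symmetric, of x "\<lambda>a. a \<le> 1"] by (auto simp: le_Suc_eq)
  then show ?thesis unfolding mem_Bool_alg set_eq_iff by blast
qed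

lemma finite_Bool_alg: "finite (Bool_alg n)"
  by (simp add: Bool_alg_alt finite_lists_length_eq)

lemma card_Bool_alg: "card (Bool_alg n) = 2 ^ n"
  using card_lists_length_eq[of "{0, 1 :: nat}" n] by (simp add: Bool_alg_alt numeral_2_eq_2)

lemma Bool_alg_0: "Bool_alg 0 = {[]}"
  by (auto simp: Bool_alg_alt)

lemma Bool_alg_Suc: "Bool_alg (Suc n) = {x @ [c] | x c. x \<in> Bool_alg n \<and> c \<le> 1}"
proof -
  have "y \<in> {x @ [c] | x c. x \<in> Bool_alg n \<and> c \<le> 1}" if "y \<in> Bool_alg (Suc n)" for y
    using that by (cases y rule: rev_cases) (auto simp: Bool_alg_alt)
  moreover have "x @ [c] \<in> Bool_alg (Suc n)" if "x \<in> Bool_alg n" "c \<le> 1" for x and c :: nat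
    using that by (auto simp: Bool_alg_alt le_Suc_eq)
  ultimately show ?thesis by blast
qed

lemma count_ones:
  assumes "x \<in> Bool_alg n"
  shows "card {i. i < n \<and> x ! i = 1} = sum_list x"
proof -
  have "sum_list x = (\<Sum>i<n. if x ! i = 1 then 1 else 0)"
    using assms unfolding sum_list_sum_nth
    by (auto simp: mem_Bool_alg le_Suc_eq atLeast0LessThan intro!: sum.cong)
  also have "\<dots> = card {i. i < n \<and> x ! i = 1}"
    by (subst sum.inter_filter[symmetric]) auto
  finally show ?thesis ..
qed

lemma count_zeros:
  assumes "x \<in> Bool_alg n"
  shows "card {i. i < n \<and> x ! i = 0} = n - sum_list x" "sum_list x \<le> n"
proof -
  have "{..<n} = {i. i < n \<and> x ! i = 0} \<union> {i. i < n \<and> x ! i = 1}"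
    using assms by (auto simp: mem_Bool_alg le_Suc_eq)
  then have "n = card ({i. i < n \<and> x ! i = 0} \<union> {i. i < n \<and> x ! i = 1})"
    by (metis card_lessThan)
  also have "\<dots> = card {i. i < n \<and> x ! i = 0} + sum_list x"
    using count_ones[OF assms] by (subst card_Un_disjoint) auto
  finally show "card {i. i < n \<and> x ! i = 0} = n - sum_list x" "sum_list x \<le> n" by auto
qed

lemma Max_rank_Bool_alg: "poset_rank (Bool_alg n) sum_list = n"
  unfolding poset_rank_def
proof (rule Max_eqI)
  show "n \<in> sum_list ` Bool_alg n"
    by (rule image_eqI[of _ _ "replicate n 1"]) (auto simp: sum_list_replicate mem_Bool_alg)
qed (use count_zeros(2) finite_Bool_alg in auto)

text \<open>\<open>flip n 0 1\<close> and \<open>flip n 1 0\<close> are the up and the down operator of the Boolean algebra.\<close>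

definition flip :: "nat \<Rightarrow> nat \<Rightarrow> nat \<Rightarrow> (nat list \<Rightarrow>\<^sub>0 complex) \<Rightarrow> (nat list \<Rightarrow>\<^sub>0 complex)" where
  "flip n a b = lin (\<lambda>x. \<Sum>i | i < n \<and> x ! i = a. bvec (x[i := b]))"

lemma linear_op_flip: "linear_op (flip n a b)"
  by (simp add: flip_def linear_op_lin)

lemma linear_op_append: "linear_op (append_coord c)"
  by (simp add: append_coord_def linear_op_lin)

lemma linear_op_subst_action: "linear_op (subst_action \<sigma>)"
  by (simp add: subst_action_def linear_op_lin)

lemmas flip_add = module_hom.add[OF linear_op_flip]
  and flip_scale = module_hom.scale[OF linear_op_flip]
  and flip_zero = module_hom.zero[OF linear_op_flip]
  and flip_diff = module_hom.diff[OF linear_op_flip]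
lemmas append_add = module_hom.add[OF linear_op_append]
  and append_scale = module_hom.scale[OF linear_op_append]
  and append_zero = module_hom.zero[OF linear_op_append]
  and append_diff = module_hom.diff[OF linear_op_append]
  and append_sum = module_hom.sum[OF linear_op_append]
lemmas subst_action_add = module_hom.add[OF linear_op_subst_action]
  and subst_action_scale = module_hom.scale[OF linear_op_subst_action]
  and subst_action_diff = module_hom.diff[OF linear_op_subst_action]

lemma append_coord_bvec [simp]: "append_coord c (bvec x) = bvec (x @ [c])"
  by (simp add: append_coord_def)

lemma subst_action_bvec [simp]: "subst_action \<sigma> (bvec x) = bvec (permute_list (inv \<sigma>) x)"
  by (simp add: subst_action_def)

lemma flip_bvec [simp]: "flip n a b (bvec x) = (\<Sum>i | i < n \<and> x ! i = a. bvec (x[i := b]))"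
  by (simp add: flip_def)

lemma append_level:
  assumes "w \<in> vspace (level (Bool_alg n) sum_list k)" "c \<le> 1"
  shows "append_coord c w \<in> vspace (level (Bool_alg (Suc n)) sum_list (k + c))"
  by (rule linear_op_vspace_mem[OF linear_op_append _ subspace_vspace assms(1)])
    (use assms(2) in \<open>auto simp: level_def Bool_alg_Suc\<close>)

lemma covers_Bool_alg:
  assumes "x \<in> Bool_alg n"
  shows "covers (Bool_alg n) tuple_le x y \<longleftrightarrow> (\<exists>i<n. x ! i = 0 \<and> y = x[i := 1])"
proof
  assume c: "covers (Bool_alg n) tuple_le x y"
  then have y: "y \<in> Bool_alg n" "tuple_le x y" "x \<noteq> y"
    and btw: "\<And>z. z \<in> Bool_alg n \<Longrightarrow> tuple_le x z \<Longrightarrow> tuple_le z y \<Longrightarrow> z = x \<or> z = y"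
    by (auto simp: covers_def)
  obtain i where i: "i < n" "x ! i \<noteq> y ! i"
    using y assms by (metis mem_Bool_alg nth_equalityI)
  moreover have "x ! i \<le> y ! i" "y ! i \<le> 1"
    using i y assms by (auto simp: tuple_le_def list_all2_conv_all_nth mem_Bool_alg)
  ultimately have xi: "x ! i = 0" "y ! i = 1" by auto
  \<comment> \<open>Raising one coordinate in which x and y differ gives a tuple between x and y, so
    the cover relation forces it to be y.\<close>
  let ?z = "x[i := 1]"
  have "?z = x \<or> ?z = y"
    using assms y i xi
    by (intro btw) (auto simp: mem_Bool_alg tuple_le_def list_all2_conv_all_nth nth_list_update)
  moreover have "?z \<noteq> x"
    using i xi assms by (metis mem_Bool_alg nth_list_update_eq zero_neq_one)
  ultimately show "\<exists>i<n. x ! i = 0 \<and> y = x[i := 1]" using i xi by blast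
next
  assume "\<exists>i<n. x ! i = 0 \<and> y = x[i := 1]"
  then obtain i where i: "i < n" "x ! i = 0" "y = x[i := 1]" by blast
  have len: "length x = n" using assms by (simp add: mem_Bool_alg)
  have "z = x \<or> z = y" if "z \<in> Bool_alg n" "tuple_le x z" "tuple_le z y" for z
  proof -
    have lz: "length z = n" and z: "\<And>j. j < n \<Longrightarrow> x ! j \<le> z ! j" "\<And>j. j < n \<Longrightarrow> z ! j \<le> y ! j"
      using that len i by (auto simp: mem_Bool_alg tuple_le_def list_all2_conv_all_nth)
    have eq: "z ! j = x ! j" if "j < n" "j \<noteq> i" for j
      using z[OF that(1)] that i(3) by simp
    have "z ! i = 0 \<or> z ! i = 1" using z(2)[OF i(1)] i len by auto
    then show ?thesis
    proof
      assume "z ! i = 0"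
      then have "z = x" using eq i len lz by (intro nth_equalityI) (auto, metis)
      then show ?thesis ..
    next
      assume "z ! i = 1"
      then have "z = y" using eq i len lz by (intro nth_equalityI) (auto simp: nth_list_update)
      then show ?thesis ..
    qed
  qed
  moreover have "y \<noteq> x" using i len by (metis nth_list_update_eq zero_neq_one)
  ultimately show "covers (Bool_alg n) tuple_le x y"
    using i assms
    by (auto simp: covers_def mem_Bool_alg tuple_le_def list_all2_conv_all_nth nth_list_update)
qed

lemma up_Bool_alg:
  assumes "v \<in> vspace (Bool_alg n)"
  shows "up (Bool_alg n) tuple_le v = flip n 0 1 v"
proof (rule linear_op_eq_on_vspace[OF _ linear_op_flip _ assms])
  show "linear_op (up (Bool_alg n) tuple_le)" by (simp add: up_def linear_op_lin)
  fix x assume x: "x \<in> Bool_alg n"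
  have "{y. covers (Bool_alg n) tuple_le x y} = (\<lambda>i. x[i := 1]) ` {i. i < n \<and> x ! i = 0}"
    by (auto simp: covers_Bool_alg[OF x])
  \<comment> \<open>Different zero coordinates yield different covers, so the sum over covers may be
    indexed by coordinates.\<close>
  moreover have "inj_on (\<lambda>i. x[i := 1]) {i. i < n \<and> x ! i = 0}"
  proof (rule inj_onI, rule ccontr)
    fix i j assume ij: "i \<in> {i. i < n \<and> x ! i = 0}" "j \<in> {i. i < n \<and> x ! i = 0}" "i \<noteq> j"
      and eq: "x[i := 1] = x[j := 1]"
    have "x[i := 1] ! i = 1" "x[j := 1] ! i = 0" using x ij by (auto simp: mem_Bool_alg)
    then show False unfolding eq by (simp only: zero_neq_one)
  qed
  ultimately show "up (Bool_alg n) tuple_le (bvec x) = flip n 0 1 (bvec x)"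
    by (simp add: up_def sum.reindex)
qed

text \<open>A Leibniz rule: the flipped coordinate is either among the first n or the appended one,
  which contributes only if it holds a.\<close>

lemma flip_append:
  assumes "w \<in> vspace (Bool_alg n)"
  shows "flip (Suc n) a b (append_coord c w) =
    append_coord c (flip n a b w) + (if c = a then append_coord b w else 0)"
proof (rule linear_op_eq_on_vspace[OF _ _ _ assms])
  show "linear_op (\<lambda>w. flip (Suc n) a b (append_coord c w))"
    by (rule linear_opI) (simp_all add: append_add append_scale flip_add flip_scale)
  show "linear_op (\<lambda>w. append_coord c (flip n a b w) + (if c = a then append_coord b w else 0))"
    by (rule linear_opI)
      (auto simp add: append_add append_scale flip_add flip_scale VS.scale_right_distrib)
  fix x assume x: "x \<in> Bool_alg n"
  then have [simp]: "length x = n" by (simp add: mem_Bool_alg)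
  have *: "{i. i < Suc n \<and> (x @ [c]) ! i = a} =
      {i. i < n \<and> x ! i = a} \<union> (if c = a then {n} else {})"
    by (auto simp: nth_append less_Suc_eq)
  show "flip (Suc n) a b (append_coord c (bvec x)) =
    append_coord c (flip n a b (bvec x)) + (if c = a then append_coord b (bvec x) else 0)"
    by (auto simp: * append_sum sum.union_disjoint list_update_append intro!: sum.cong)
qed

section \<open>The sum of all transpositions\<close>

text \<open>
  Sums over all ordered pairs, diagonal included, are twice the sum of the transpositions plus
  m times the identity, and have the simplest conjugation behaviour.
\<close>

definition transposition_row ::
  "((nat \<Rightarrow> nat) \<Rightarrow> ('a \<Rightarrow>\<^sub>0 complex) \<Rightarrow> ('a \<Rightarrow>\<^sub>0 complex)) \<Rightarrow> nat \<Rightarrow> nat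
    \<Rightarrow> ('a \<Rightarrow>\<^sub>0 complex) \<Rightarrow> ('a \<Rightarrow>\<^sub>0 complex)" where
  "transposition_row rho m i v = (\<Sum>j<m. rho (Transposition.transpose i j) v)"

definition casimir ::
  "((nat \<Rightarrow> nat) \<Rightarrow> ('a \<Rightarrow>\<^sub>0 complex) \<Rightarrow> ('a \<Rightarrow>\<^sub>0 complex)) \<Rightarrow> nat
    \<Rightarrow> ('a \<Rightarrow>\<^sub>0 complex) \<Rightarrow> ('a \<Rightarrow>\<^sub>0 complex)" where
  "casimir rho m v = (\<Sum>i<m. transposition_row rho m i v)"

text \<open>Enlarging the square of index pairs by m adds a row, a column with the same
  transpositions and the diagonal pair. The row \<open>transposition_row rho m m\<close> is the
  Jucys-Murphy element of \<open>Sym (Suc m)\<close>.\<close>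

lemma casimir_Suc:
  assumes "rho id v = v"
  shows "casimir rho (Suc m) v =
    casimir rho m v + transposition_row rho m m v + transposition_row rho m m v + v"
  using assms
  by (simp add: casimir_def transposition_row_def sum.distrib transpose_commute algebra_simps)

lemma transpose_permutes: "i < m \<Longrightarrow> j < m \<Longrightarrow> Transposition.transpose i j permutes {..<m}"
  by (auto intro!: permutes_swap_id)

section \<open>The substitution action on levels and on appended coordinates\<close>

lemma subst_action_id [simp]: "subst_action id v = v"
proof (rule linear_op_eq_on_vspace[of _ _ UNIV])
  show "linear_op (subst_action id)" "linear_op (\<lambda>v :: nat list \<Rightarrow>\<^sub>0 complex. v)"
    by (auto intro: linear_op_subst_action linear_opI)
qed (auto simp: vspace_def)

lemma subst_action_comp:
  assumes "\<sigma> permutes {..<n}" "\<tau> permutes {..<n}" "v \<in> vspace (Bool_alg n)"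
  shows "subst_action (\<sigma> \<circ> \<tau>) v = subst_action \<sigma> (subst_action \<tau> v)"
proof (rule linear_op_eq_on_vspace[OF linear_op_subst_action _ _ assms(3)])
  show "linear_op (\<lambda>v. subst_action \<sigma> (subst_action \<tau> v))"
    by (rule linear_opI) (simp_all add: subst_action_add subst_action_scale)
  fix x assume x: "x \<in> Bool_alg n"
  have "inv (\<sigma> \<circ> \<tau>) = inv \<tau> \<circ> inv \<sigma>"
    using assms by (auto intro!: o_inv_distrib dest: permutes_bij)
  then show "subst_action (\<sigma> \<circ> \<tau>) (bvec x) = subst_action \<sigma> (subst_action \<tau> (bvec x))"
    using x permute_list_compose[of "inv \<sigma>" x "inv \<tau>"] assms(1)
    by (simp add: mem_Bool_alg permutes_inv)
qed

lemma subst_action_level: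
  assumes "\<sigma> permutes {..<n}" "v \<in> vspace (level (Bool_alg n) sum_list k)"
  shows "subst_action \<sigma> v \<in> vspace (level (Bool_alg n) sum_list k)"
proof (rule linear_op_vspace_mem[OF linear_op_subst_action _ subspace_vspace assms(2)])
  fix x assume x: "x \<in> level (Bool_alg n) sum_list k"
  then have "inv \<sigma> permutes {..<length x}"
    using assms(1) by (simp add: level_def mem_Bool_alg permutes_inv)
  from set_permute_list[OF this] mset_permute_list[OF this] x
  show "subst_action \<sigma> (bvec x) \<in> vspace (level (Bool_alg n) sum_list k)"
    by (auto simp: level_def Bool_alg_alt simp flip: sum_mset_sum_list)
qed

text \<open>A permutation of the first n positions leaves the appended coordinate, at position n, in
  place.\<close>

lemma subst_action_append:
  assumes "\<sigma> permutes {..<n}" "w \<in> vspace (Bool_alg n)"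
  shows "subst_action \<sigma> (append_coord c w) = append_coord c (subst_action \<sigma> w)"
proof (rule linear_op_eq_on_vspace[OF _ _ _ assms(2)])
  show "linear_op (\<lambda>w. subst_action \<sigma> (append_coord c w))"
    "linear_op (\<lambda>w. append_coord c (subst_action \<sigma> w))"
    by (rule linear_opI, simp_all add: subst_action_add subst_action_scale append_add append_scale)+
  fix x assume "x \<in> Bool_alg n"
  then have len: "length x = n" by (simp add: mem_Bool_alg)
  have p: "inv \<sigma> permutes {..<n}" using assms(1) by (simp add: permutes_inv)
  have "permute_list (inv \<sigma>) (x @ [c]) = permute_list (inv \<sigma>) x @ [c]"
  proof (rule nth_equalityI)
    fix i assume "i < length (permute_list (inv \<sigma>) (x @ [c]))"
    then have "i < n \<or> i = n" using len by auto
    then show "permute_list (inv \<sigma>) (x @ [c]) ! i = (permute_list (inv \<sigma>) x @ [c]) ! i"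
      using len permutes_in_image[OF p, of i] permutes_not_in[OF p, of i]
      by (auto simp: permute_list_def nth_append)
  qed simp
  then show "subst_action \<sigma> (append_coord c (bvec x)) = append_coord c (subst_action \<sigma> (bvec x))"
    by simp
qed

lemma casimir_append:
  assumes "m \<le> n" "w \<in> vspace (Bool_alg n)"
  shows "casimir subst_action m (append_coord c w) = append_coord c (casimir subst_action m w)"
proof -
  have "subst_action (Transposition.transpose i j) (append_coord c w) =
      append_coord c (subst_action (Transposition.transpose i j) w)" if "i < m" "j < m" for i j
    using that assms by (intro subst_action_append transpose_permutes) auto
  then show ?thesis
    by (simp add: casimir_def transposition_row_def append_sum)
qed

lemma linear_op_casimir:
  assumes "\<And>\<sigma>. linear_op (rho \<sigma>)"
  shows "linear_op (casimir rho m)"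
  by (rule linear_opI) (simp_all add: casimir_def transposition_row_def VS.scale_sum_right
      module_hom.add[OF assms] module_hom.scale[OF assms] sum.distrib)

text \<open>Exchanging position n, which holds c, with position i changes nothing if entry i is also
  c; these i contribute the scalar. Otherwise entry i becomes c and the last entry becomes the other
  value e, which is \<open>append_coord e\<close> after \<open>flip n e c\<close>.\<close>

lemma transposition_row_append:
  assumes w: "w \<in> vspace (level (Bool_alg n) sum_list k)"
  shows "transposition_row subst_action n n (append_coord 0 w) =
      scale (of_nat n - of_nat k) (append_coord 0 w) + append_coord 1 (flip n 1 0 w)" (is ?zero)
    and "transposition_row subst_action n n (append_coord 1 w) =
      scale (of_nat k) (append_coord 1 w) + append_coord 0 (flip n 0 1 w)" (is ?one)
proof -
  have lin: "linear_op (\<lambda>w. transposition_row subst_action n n (append_coord c w))"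
    "linear_op (\<lambda>w. scale d (append_coord c w) + append_coord e (flip n e c w))" for c d e
    by (rule linear_opI, simp_all add: transposition_row_def append_add append_scale
        subst_action_add subst_action_scale flip_add flip_scale sum.distrib VS.scale_sum_right
        VS.scale_right_distrib VS.scale_left_commute algebra_simps)+
  have swap: "permute_list (inv (Transposition.transpose n i)) (x @ [c]) = x[i := c] @ [x ! i]"
    if "i < n" "length x = n" for x i and c :: nat
  proof (rule nth_equalityI)
    fix j assume "j < length (permute_list (inv (Transposition.transpose n i)) (x @ [c]))"
    then have "j < n \<or> j = n" using that by auto
    then show "permute_list (inv (Transposition.transpose n i)) (x @ [c]) ! j =
        (x[i := c] @ [x ! i]) ! j"
      using that by (cases "j = i") (auto simp: permute_list_def nth_append)
  qed simp
  have row: "transposition_row subst_action n n (append_coord c (bvec x)) =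
      scale (of_nat (card {i. i < n \<and> x ! i = c})) (append_coord c (bvec x))
      + append_coord e (flip n e c (bvec x))"
    if x: "x \<in> Bool_alg n" and ce: "{c, e} = {0, 1}" for x c e
  proof -
    have len: "length x = n" using x by (simp add: mem_Bool_alg)
    have split: "{..<n} = {i. i < n \<and> x ! i = c} \<union> {i. i < n \<and> x ! i = e}" "c \<noteq> e"
      using x ce by (auto simp: mem_Bool_alg le_Suc_eq doubleton_eq_iff)
    have "transposition_row subst_action n n (append_coord c (bvec x)) =
        (\<Sum>i<n. bvec (x[i := c] @ [x ! i]))"
      using len by (simp add: transposition_row_def swap del: inv_transpose_eq)
    also have "\<dots> = (\<Sum>i | i < n \<and> x ! i = c. bvec (x[i := c] @ [x ! i])) +
        (\<Sum>i | i < n \<and> x ! i = e. bvec (x[i := c] @ [x ! i]))"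
      unfolding split(1) by (rule sum.union_disjoint) (use split(2) in auto)
    also have "(\<Sum>i | i < n \<and> x ! i = c. bvec (x[i := c] @ [x ! i])) =
        (\<Sum>i | i < n \<and> x ! i = c. bvec (x @ [c]))"
      by (intro sum.cong) (auto simp: list_update_same_conv len)
    also have "\<dots> = scale (of_nat (card {i. i < n \<and> x ! i = c})) (append_coord c (bvec x))"
      by (simp only: VS.sum_constant_scale append_coord_bvec)
    finally show ?thesis by (simp add: append_sum)
  qed
  show ?zero
    by (rule linear_op_eq_on_vspace[OF lin(1) lin(2) _ w])
      (subst row[where e = 1], auto simp: level_def count_zeros of_nat_diff)
  show ?one
    by (rule linear_op_eq_on_vspace[OF lin(1) lin(2) _ w])
      (subst row[where e = 0], auto simp: level_def count_ones[simplified])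
qed

section \<open>Gelfand-Tsetlin bases from joint eigenbases\<close>

text \<open>The coordinates of y with respect to B are supported in S and also in T, hence
  nowhere.\<close>

lemma independent_span_Int:
  assumes "VS.independent B" "S \<subseteq> B" "T \<subseteq> B" "S \<inter> T = {}" "y \<in> VS.span S" "y \<in> VS.span T"
  shows "y = 0"
proof -
  have "VS.representation B y = VS.representation S y" "VS.representation B y = VS.representation T y"
    by (rule VS.representation_extend[OF assms(1)]; use assms in simp)+
  then have "VS.representation B y b = 0" for b
    using VS.representation_ne_zero[of S y b] VS.representation_ne_zero[of T y b] assms(4) by auto
  moreover have "y \<in> VS.span B" using assms VS.span_mono by blast
  ultimately show ?thesis
    using VS.sum_nonzero_representation_eq[OF assms(1), of y] by simp
qed

section \<open>Arithmetic of the eigenvalues\<close>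

text \<open>m plus twice the sum of the contents of the Young diagram with rows m - r and r.\<close>

definition ev :: "nat \<Rightarrow> nat \<Rightarrow> complex" where
  "ev m r = of_nat m ^ 2 - 2 * of_nat r * (of_nat m - of_nat r + 1)"

text \<open>The difference of the two values is 2 (s - r) (m + 1 - s - r), and the last factor is
  positive because r + s is at most m.\<close>

lemma ev_inj:
  assumes "2 * r \<le> m" "2 * s \<le> m" "ev m r = ev m s"
  shows "r = s"
proof (rule ccontr)
  assume "r \<noteq> s"
  have "2 * ((of_nat s - of_nat r) * (of_nat m + 1 - of_nat s - of_nat r)) = (0 :: complex)"
    using assms(3) by (simp add: ev_def power2_eq_square algebra_simps)
  then have "of_nat s - of_nat r = (0 :: complex) \<or> of_nat m + 1 - of_nat s - of_nat r = (0 :: complex)"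
    by (simp only: mult_eq_0_iff zero_neq_numeral[symmetric]) simp
  with \<open>r \<noteq> s\<close> have "of_nat (m + 1) = (of_nat (s + r) :: complex)"
    by (auto simp: algebra_simps)
  then have "m + 1 = s + r" by (simp only: of_nat_eq_iff)
  then show False using assms by simp
qed

text \<open>The first assumption is the relation produced by \<open>scalar_casimirs\<close> when the
  label stays r. It amounts to r (2 r - m - 3) = 0 and so leaves only the one-row diagram.\<close>

lemma ev_Suc_same:
  assumes "2 * ev (Suc m) r = of_nat (Suc m) * (ev (Suc m) r - ev m r + 1)" "2 * r \<le> m"
  shows "r = 0"
proof (rule ccontr)
  assume "r \<noteq> 0"
  have "2 * (of_nat r * (2 * of_nat r - of_nat (m + 3))) = (0 :: complex)"
    using assms(1) by (simp add: ev_def power2_eq_square algebra_simps)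
  with \<open>r \<noteq> 0\<close> have "of_nat (2 * r) = (of_nat (m + 3) :: complex)" by auto
  then have "2 * r = m + 3" by (simp only: of_nat_eq_iff)
  then show False using assms(2) by simp
qed

text \<open>Here the label grows from r to r + 1, and the relation factors as (m + 1 - 2 (r + 1)) (m
  + 1 - r) = 0. Its relevant solution is a diagram with two equal rows, which like the one-row
  diagram has a single removable box.\<close>

lemma ev_Suc_step:
  assumes "2 * ev (Suc m) (Suc r) = of_nat (Suc m) * (ev (Suc m) (Suc r) - ev m r + 1)"
  shows "\<not> 2 * Suc r \<le> m"
proof
  assume le: "2 * Suc r \<le> m"
  have "2 * ((of_nat (Suc m) - of_nat (2 * Suc r)) * (of_nat (Suc m) - of_nat r)) = (0 :: complex)"
    using assms by (simp add: ev_def power2_eq_square algebra_simps)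
  then have "of_nat (Suc m) = (of_nat (2 * Suc r) :: complex) \<or> of_nat (Suc m) = (of_nat r :: complex)"
    by (simp only: mult_eq_0_iff right_minus_eq) simp
  then have "Suc m = 2 * Suc r \<or> Suc m = r" by (simp only: of_nat_eq_iff)
  then show False using le by auto
qed

lemma permutes_mono: "\<sigma> permutes {..<m} \<Longrightarrow> m \<le> j \<Longrightarrow> \<sigma> permutes {..<j :: nat}"
  by (erule permutes_subset) auto

text \<open>\<open>lab v m\<close> stands for the length of the second row of a diagram with m
  boxes; \<open>lab_bound\<close> and \<open>lab_step\<close> say that v follows a path of two-row
  diagrams growing by one box. The laws \<open>rho_comp\<close> and \<open>rho_closed\<close> are
  confined to the span of B, matching \<open>subst_action_comp\<close>, which concerns tuples of
  length n.\<close>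

locale gz_eigenbasis =
  fixes rho :: "(nat \<Rightarrow> nat) \<Rightarrow> ('a \<Rightarrow>\<^sub>0 complex) \<Rightarrow> ('a \<Rightarrow>\<^sub>0 complex)"
    and n :: nat and B :: "('a \<Rightarrow>\<^sub>0 complex) set" and lab :: "('a \<Rightarrow>\<^sub>0 complex) \<Rightarrow> nat \<Rightarrow> nat"
  assumes linear_rho: "linear_op (rho \<sigma>)"
    and rho_id: "rho id v = v"
    and rho_comp: "\<lbrakk>\<sigma> permutes {..<n}; \<tau> permutes {..<n}; v \<in> VS.span B\<rbrakk>
      \<Longrightarrow> rho (\<sigma> \<circ> \<tau>) v = rho \<sigma> (rho \<tau> v)"
    and rho_closed: "\<lbrakk>\<sigma> permutes {..<n}; v \<in> VS.span B\<rbrakk> \<Longrightarrow> rho \<sigma> v \<in> VS.span B"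
    and finite_basis: "finite B"
    and independent_basis: "VS.independent B"
    and eigen: "\<lbrakk>v \<in> B; m \<le> n\<rbrakk> \<Longrightarrow>
casimir rho m v = scale (ev m (lab v m)) v"
    and lab_bound: "\<lbrakk>v \<in> B; m \<le> n\<rbrakk> \<Longrightarrow> 2 * lab v m \<le> m"
    and lab_step: "\<lbrakk>v \<in> B; m < n\<rbrakk> \<Longrightarrow> lab v (Suc m) = lab v m \<or> lab v (Suc m) = Suc (lab v m)"
    and lab_inj: "\<lbrakk>v \<in> B; w \<in> B; \<And>m. m \<le> n \<Longrightarrow> lab v m = lab w m\<rbrakk> \<Longrightarrow> v = w"
begin

text \<open>For m \<le> n and v in B, the span turns out to be the irreducible
  \<open>Sym m\<close>-summand that contains v. At \<open>Suc n\<close> no label is prescribed and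
  the branch is all of B.\<close>

definition branch :: "nat \<Rightarrow> ('a \<Rightarrow>\<^sub>0 complex) \<Rightarrow> ('a \<Rightarrow>\<^sub>0 complex) set" where
  "branch m v = {w\<in>B. \<forall>j. m \<le> j \<and> j \<le> n \<longrightarrow> lab w j = lab v j}"

lemma casimir_linear: "linear_op (casimir rho m)"
  by (rule linear_op_casimir[OF linear_rho])

lemma basis_nonzero: "v \<in> B \<Longrightarrow> v \<noteq> 0"
  using VS.dependent_zero independent_basis by blast

lemma branch_subset: "branch m v \<subseteq> B"
  by (auto simp: branch_def)

lemma branch_self: "v \<in> B \<Longrightarrow> v \<in> branch m v"
  by (auto simp: branch_def)

lemma span_branch_subset: "VS.span (branch m v) \<subseteq> VS.span B"
  by (rule VS.span_mono[OF branch_subset])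

lemma branch_eq: "w \<in> branch m v \<Longrightarrow> branch m w = branch m v"
  by (auto simp: branch_def)

lemma branch_trans: "w \<in> branch (Suc m) v \<Longrightarrow> branch m w \<subseteq> branch (Suc m) v"
  by (auto simp: branch_def)

lemma branch_0: "v \<in> B \<Longrightarrow> branch 0 v = {v}"
  using lab_inj by (auto simp: branch_def)

text \<open>The label at level 0 is always 0 by \<open>lab_bound\<close>, so the labels from level 1
  on already single out v. This lets the recursion of \<open>gz_decomposition\<close> end in
  lines.\<close>

lemma branch_1: assumes "v \<in> B" shows "branch (Suc 0) v = {v}"
proof -
  have "lab w 0 = 0" if "w \<in> B" for w
    using lab_bound[OF that, of 0] by simp
  then have "branch (Suc 0) v = branch 0 v"
    using assms by (auto simp: branch_def) (metis Suc_leI gr0I)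
  then show ?thesis using assms branch_0 by simp
qed

lemma branch_top: "branch (Suc n) v = B"
  by (auto simp: branch_def)

text \<open>Identifies the span with a joint eigenspace. When x is expanded in B, a nonzero
  coefficient at b forces the eigenvalues of b and v to agree at each prescribed level, and
  \<open>ev_inj\<close> turns this into equality of labels.\<close>

lemma span_branch_iff:
  assumes x: "x \<in> VS.span B" and "v \<in> B"
  shows "x \<in> VS.span (branch m v) \<longleftrightarrow>
    (\<forall>j. m \<le> j \<and> j \<le> n \<longrightarrow> casimir rho j x = scale (ev j (lab v j)) x)"
proof (intro iffI allI impI)
  fix j assume xm: "x \<in> VS.span (branch m v)" and j: "m \<le> j \<and> j \<le> n"
  show "casimir rho j x = scale (ev j (lab v j)) x"
    by (rule VSP.module_hom_eq_on_span[OF casimir_linear linear_op_scale _ xm])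
      (use j in \<open>auto simp: branch_def eigen\<close>)
next
  assume eig: "\<forall>j. m \<le> j \<and> j \<le> n \<longrightarrow> casimir rho j x = scale (ev j (lab v j)) x"
  obtain c where c: "x = (\<Sum>b\<in>B. scale (c b) b)"
    using x VS.span_finite[OF finite_basis] by auto
  have "b \<in> branch m v" if b: "b \<in> B" "c b \<noteq> 0" for b
  proof -
    have "lab b j = lab v j" if j: "m \<le> j" "j \<le> n" for j
    proof -
      have "0 = casimir rho j x - scale (ev j (lab v j)) x" using eig j by simp
      also have "casimir rho j x = (\<Sum>b\<in>B. scale (c b * ev j (lab b j)) b)"
        by (simp add: c module_hom.sum[OF casimir_linear] module_hom.scale[OF casimir_linear]
            eigen j)
      also have "\<dots> - scale (ev j (lab v j)) x =
          (\<Sum>b\<in>B. scale (c b * (ev j (lab b j) - ev j (lab v j))) b)"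
        by (simp add: c VS.scale_sum_right sum_subtractf VS.scale_left_diff_distrib
            right_diff_distrib mult.commute)
      finally have "(\<Sum>b\<in>B. scale (c b * (ev j (lab b j) - ev j (lab v j))) b) = 0" ..
      from VS.independentD[OF independent_basis finite_basis subset_refl this b(1)]
      have "c b * (ev j (lab b j) - ev j (lab v j)) = 0" .
      then have "ev j (lab b j) = ev j (lab v j)" using b(2) by simp
      then show ?thesis
        using b(1) \<open>v \<in> B\<close> j ev_inj lab_bound by blast
    qed
    then show ?thesis using b by (simp add: branch_def)
  qed
  then have "scale (c b) b \<in> VS.span (branch m v)" if "b \<in> B" for b
    using that by (cases "c b = 0") (auto intro: VS.span_scale VS.span_base VS.span_zero)
  then show "x \<in> VS.span (branch m v)"
    unfolding c by (intro VS.span_sum) auto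
qed

lemma basis_in_span_branch:
  assumes "v \<in> B" "w \<in> B"
  shows "w \<in> VS.span (branch m v) \<longleftrightarrow> w \<in> branch m v"
proof
  assume w: "w \<in> VS.span (branch m v)"
  have "lab w j = lab v j" if "m \<le> j" "j \<le> n" for j
  proof -
    have "scale (ev j (lab w j)) w = scale (ev j (lab v j)) w"
      using w that assms span_branch_iff[of w v m] VS.span_base[OF assms(2)] eigen by metis
    then have "ev j (lab w j) = ev j (lab v j)"
      using basis_nonzero[OF assms(2)] by (simp only: VS.scale_cancel_right simp_thms)
    then show ?thesis
      using ev_inj lab_bound assms that by blast
  qed
  then show "w \<in> branch m v" using assms by (simp add: branch_def)
qed (rule VS.span_base)

section \<open>Conjugation of transposition sums and invariance of branches\<close>

lemma transposition_row_conj: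
  assumes "\<sigma> permutes {..<m}" "m \<le> n" "i < m" "x \<in> VS.span B"
  shows "rho \<sigma> (transposition_row rho m i x) = transposition_row rho m (\<sigma> i) (rho \<sigma> x)"
proof -
  have \<sigma>: "\<sigma> permutes {..<n}" using assms permutes_mono by blast
  have "rho \<sigma> (transposition_row rho m i x) =
      (\<Sum>j<m. rho \<sigma> (rho (Transposition.transpose i j) x))"
    by (simp add: transposition_row_def module_hom.sum[OF linear_rho])
  also have "\<dots> = (\<Sum>j<m. rho (Transposition.transpose (\<sigma> i) (\<sigma> j)) (rho \<sigma> x))"
  proof (rule sum.cong[OF refl])
    fix j assume "j \<in> {..<m}"
    then have j: "j < m" "\<sigma> j < m" "\<sigma> i < m"
      using assms permutes_in_image[OF assms(1)] by auto
    \<comment> \<open>Conjugation by \<sigma> sends the transposition of i and j to that of their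
      images; stated without inverses to fit \<open>rho_comp\<close>.\<close>
    have "\<sigma> \<circ> Transposition.transpose i j = Transposition.transpose (\<sigma> i) (\<sigma> j) \<circ> \<sigma>"
      using permutes_inj[OF \<sigma>] by (auto simp: fun_eq_iff Transposition.transpose_def inj_eq)
    then have "rho (\<sigma> \<circ> Transposition.transpose i j) x =
        rho (Transposition.transpose (\<sigma> i) (\<sigma> j) \<circ> \<sigma>) x" by simp
    then show "rho \<sigma> (rho (Transposition.transpose i j) x) =
        rho (Transposition.transpose (\<sigma> i) (\<sigma> j)) (rho \<sigma> x)"
      using j assms \<sigma> by (simp add: rho_comp transpose_permutes)
  qed
  also have "\<dots> = (\<Sum>j<m. rho (Transposition.transpose (\<sigma> i) j) (rho \<sigma> x))"
    by (rule sum.reindex_bij_betw[OF permutes_imp_bij[OF assms(1)]])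
  finally show ?thesis by (simp add: transposition_row_def)
qed

text \<open>Conjugation only permutes the rows, so their sum is central.\<close>

lemma casimir_commute:
  assumes "\<sigma> permutes {..<m}" "m \<le> n" "x \<in> VS.span B"
  shows "casimir rho m (rho \<sigma> x) = rho \<sigma> (casimir rho m x)"
proof -
  have "rho \<sigma> (casimir rho m x) = (\<Sum>i<m. transposition_row rho m (\<sigma> i) (rho \<sigma> x))"
    using assms by (simp add: casimir_def module_hom.sum[OF linear_rho] transposition_row_conj)
  also have "\<dots> = (\<Sum>i<m. transposition_row rho m i (rho \<sigma> x))"
    by (rule sum.reindex_bij_betw[OF permutes_imp_bij[OF assms(1)]])
  finally show ?thesis by (simp add: casimir_def)
qed

text \<open>The span is cut out by eigenvalue conditions at levels j \<ge> m, and the sum at each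
  such level commutes with \<open>Sym m\<close>. The minimum also admits the top branch
  \<open>Suc n\<close>, acted on by \<open>Sym n\<close>.\<close>

lemma submodule_span_branch:
  assumes "v \<in> B" "m \<le> Suc n"
  shows "submodule rho (Sym (min m n)) (VS.span (branch m v))"
  unfolding submodule_def
proof (intro conjI ballI)
  fix \<sigma> x assume \<sigma>: "\<sigma> \<in> Sym (min m n)" and x: "x \<in> VS.span (branch m v)"
  then have xB: "x \<in> VS.span B" using span_branch_subset by blast
  have \<sigma>': "\<sigma> permutes {..<min m n}" using \<sigma> by (simp add: Sym_def)
  have "casimir rho j (rho \<sigma> x) = scale (ev j (lab v j)) (rho \<sigma> x)" if "m \<le> j" "j \<le> n" for j
    using casimir_commute[OF permutes_mono[OF \<sigma>'], of j x] that xB x assms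
    by (simp add: span_branch_iff module_hom.scale[OF linear_rho])
  then show "rho \<sigma> x \<in> VS.span (branch m v)"
    using span_branch_iff[of "rho \<sigma> x" v m] assms rho_closed[OF permutes_mono[OF \<sigma>'] xB] by simp
qed simp

section \<open>Irreducibility of the branches\<close>

lemma submodule_mono:
  "submodule rho (Sym j) X \<Longrightarrow> m \<le> j \<Longrightarrow> submodule rho (Sym m) X"
  using permutes_mono by (auto simp: submodule_def Sym_def)

lemma casimir_mem:
  assumes "submodule rho (Sym m) X" "x \<in> X"
  shows "casimir rho m x \<in> X"
  unfolding casimir_def transposition_row_def
  using assms by (intro VS.subspace_sum) (auto simp: submodule_def Sym_def transpose_permutes)

text \<open>
  If the sums for Sym m and Sym (m + 1) both act as scalars on a module over Sym (m + 1), then so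
  does their difference, the last row, and hence each row, as the rows are conjugate.
\<close>

lemma scalar_casimirs:
  assumes sub: "submodule rho (Sym (Suc m)) X" and X: "X \<subseteq> VS.span B" and m: "Suc m \<le> n"
    and x: "x \<in> X" "x \<noteq> 0"
    and a: "\<And>y. y \<in> X \<Longrightarrow> casimir rho m y = scale a y"
    and b: "\<And>y. y \<in> X \<Longrightarrow> casimir rho (Suc m) y = scale b y"
  shows "2 * b = of_nat (Suc m) * (b - a + 1)"
proof -
  let ?R = "transposition_row rho (Suc m)"
  let ?t = "\<lambda>i. Transposition.transpose i m"
  have two: "scale 2 y = y + y" for y :: "'a \<Rightarrow>\<^sub>0 complex"
    using VS.scale_left_distrib[of 1 1 y] by simp
  \<comment> \<open>Row m over \<open>Suc m\<close> includes the diagonal pair: twice the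
    Jucys-Murphy element acts by b - a - 1, and twice the identity raises this to b - a + 1.\<close>
  have last: "scale 2 (?R m y) = scale (b - a + 1) y" if "y \<in> X" for y
  proof -
    have "?R m y = transposition_row rho m m y + y"
      by (simp add: transposition_row_def rho_id)
    then show ?thesis
      using casimir_Suc[of rho y m] a[OF that] b[OF that]
      by (simp add: rho_id two VS.scale_left_distrib VS.scale_left_diff_distrib algebra_simps)
  qed
  have row: "scale 2 (?R i x) = scale (b - a + 1) x" if "i < Suc m" for i
  proof -
    have t: "?t i permutes {..<Suc m}" using that by (intro transpose_permutes) auto
    then have tn: "?t i permutes {..<n}" using permutes_mono m by blast
    have tx: "rho (?t i) x \<in> X" using sub x t by (auto simp: submodule_def Sym_def)
    have ttx: "rho (?t i) (rho (?t i) x) = x"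
      using rho_comp[OF tn tn, of x] x X by (auto simp: rho_id)
    have "scale 2 (?R i x) = rho (?t i) (scale 2 (?R m (rho (?t i) x)))"
      using transposition_row_conj[OF t m, of m "rho (?t i) x"] tx X ttx
      by (auto simp: module_hom.scale[OF linear_rho])
    also have "\<dots> = scale (b - a + 1) x"
      unfolding last[OF tx] using ttx by (simp add: module_hom.scale[OF linear_rho])
    finally show ?thesis .
  qed
  have "scale (2 * b) x = scale 2 (casimir rho (Suc m) x)" using b x by simp
  also have "\<dots> = (\<Sum>i<Suc m. scale 2 (?R i x))"
    unfolding casimir_def by (rule VS.scale_sum_right)
  also have "\<dots> = (\<Sum>i<Suc m. scale (b - a + 1) x)"
    by (rule sum.cong) (use row in auto)
  also have "\<dots> = scale (of_nat (Suc m) * (b - a + 1)) x"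
    by (simp only: VS.sum_constant_scale card_lessThan VS.scale_scale)
  finally show ?thesis using x by (simp only: VS.scale_cancel_right simp_thms)
qed

text \<open>Over \<open>Sym m\<close> the span splits into at most two irreducible pieces with
  different eigenvalues. An invariant X that misses one piece lies inside the other, and then
  \<open>scalar_casimirs\<close> yields a relation that the labels exclude.\<close>

lemma irreducible_span_branch:
  assumes "v \<in> B" "m \<le> n"
  shows "irreducible_module rho (Sym m) (VS.span (branch m v))"
  using assms
proof (induction m arbitrary: v)
  case 0
  have sp: "VS.span (branch 0 v) = VS.span {v}" using branch_0 0 by simp
  show ?case
    unfolding irreducible_module_def
  proof (intro conjI allI impI)
    show "submodule rho (Sym 0) (VS.span (branch 0 v))"
      using submodule_span_branch[OF 0(1), of 0] by simp
    show "VS.span (branch 0 v) \<noteq> {0}"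
      using VS.span_base[OF branch_self[OF 0(1)]] basis_nonzero[OF 0(1)] by blast
    fix X assume X: "submodule rho (Sym 0) X \<and> X \<subseteq> VS.span (branch 0 v)"
    show "X = {0} \<or> X = VS.span (branch 0 v)"
    proof (cases "X \<subseteq> {0}")
      case False
      then obtain c where c: "scale c v \<in> X" "scale c v \<noteq> 0"
        using X unfolding sp VS.span_singleton by blast
      then have "c \<noteq> 0" by auto
      moreover have "scale (inverse c) (scale c v) \<in> X"
        using X c VS.subspace_scale unfolding submodule_def by blast
      ultimately have "v \<in> X" by simp
      then have "VS.span {v} \<subseteq> X" using X by (intro VS.span_minimal) (auto simp: submodule_def)
      then show ?thesis using X sp by auto
    qed (use X VS.subspace_0 in \<open>auto simp: submodule_def\<close>)
  qed
next
  case (Suc m)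
  let ?W = "VS.span (branch (Suc m) v)"
  let ?r = "lab v (Suc m)"
  let ?S = "\<lambda>s. {w \<in> branch (Suc m) v. lab w m = s}"
  \<comment> \<open>Once the labels from \<open>Suc m\<close> on are fixed, the label at m alone
    names the smaller branch.\<close>
  have S_branch: "?S (lab w m) = branch m w" if "w \<in> branch (Suc m) v" for w
    using that Suc.prems by (auto simp: branch_def) (metis le_antisym not_less_eq_eq)
  have mn: "m < n" "m \<le> n" "Suc m \<le> n" using Suc.prems by auto
  show ?case
    unfolding irreducible_module_def
  proof (intro conjI allI impI)
    show "submodule rho (Sym (Suc m)) ?W"
      using submodule_span_branch[OF Suc.prems(1), of "Suc m"] mn by (simp add: min_absorb1)
    show "?W \<noteq> {0}"
      using VS.span_base[OF branch_self[OF Suc.prems(1)]] basis_nonzero[OF Suc.prems(1)] by blast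
    fix X assume X: "submodule rho (Sym (Suc m)) X \<and> X \<subseteq> ?W"
    then have subX: "VS.subspace X" by (simp add: submodule_def)
    have Xm: "submodule rho (Sym m) X"
      by (rule submodule_mono[of "Suc m"]) (use X in auto)
    have XB: "X \<subseteq> VS.span B" using X span_branch_subset by blast
    \<comment> \<open>X meets each piece in a \<open>Sym m\<close>-submodule, and the piece is
      irreducible by the induction hypothesis.\<close>
    have dichotomy: "X \<inter> VS.span (branch m w) = {0} \<or> VS.span (branch m w) \<subseteq> X"
      if "w \<in> B" for w
    proof -
      have "submodule rho (Sym m) (X \<inter> VS.span (branch m w))"
        using Xm submodule_span_branch[OF that, of m] mn
        by (auto simp: submodule_def VS.subspace_inter min_absorb1)
      then show ?thesis
        using Suc.IH[OF that mn(2)] unfolding irreducible_module_def by blast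
    qed
    show "X = {0} \<or> X = ?W"
    proof (cases "\<forall>w\<in>branch (Suc m) v. VS.span (branch m w) \<subseteq> X")
      case True
      then have "branch (Suc m) v \<subseteq> X"
        using VS.span_base branch_self branch_subset by blast
      then have "?W \<subseteq> X" using subX by (rule VS.span_minimal)
      then show ?thesis using X by blast
    next
      case False
      then obtain w where w: "w \<in> branch (Suc m) v" "\<not> VS.span (branch m w) \<subseteq> X" by blast
      then have wB: "w \<in> B" using branch_subset by blast
      let ?s = "lab w m"
      have labs: "lab u m = ?r \<or> Suc (lab u m) = ?r" if "u \<in> branch (Suc m) v" for u
        using that lab_step[of u m] mn by (auto simp: branch_def)
      show ?thesis
      proof (cases "\<exists>u\<in>branch (Suc m) v. lab u m \<noteq> ?s")
        \<comment> \<open>With a single label at m, the whole span is one piece and the dichotomy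
          suffices.\<close>
        case False
        then have "branch (Suc m) v = branch m w" using S_branch[OF w(1)] by blast
        then have "X \<inter> ?W = {0}" using dichotomy[OF wB] w(2) by simp
        then show ?thesis using X by blast
      next
        case True
        then obtain u where u: "u \<in> branch (Suc m) v" "lab u m \<noteq> ?s" by blast
        then have uB: "u \<in> B" using branch_subset by blast
        let ?t = "lab u m"
        have "lab x m = ?t \<or> lab x m = ?s" if "x \<in> branch (Suc m) v" for x
          using labs[OF that] labs[OF u(1)] labs[OF w(1)] u(2) by auto
        then have "branch (Suc m) v = ?S ?t \<union> ?S ?s" by blast
        then have W_eq: "branch (Suc m) v = branch m u \<union> branch m w"
          by (simp only: S_branch[OF u(1)] S_branch[OF w(1)])
        have ev_ne: "ev m ?s \<noteq> ev m ?t"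
          using ev_inj lab_bound u uB wB mn by metis
        \<comment> \<open>Subtracting the eigenvalue of u from \<open>casimir rho m\<close> kills
          the component p and rescales q by a nonzero number. Thus q lies in X, which meets the
          piece of w only in 0.\<close>
        have parts: "y \<in> VS.span (branch m u)" if y: "y \<in> X" for y
        proof -
          obtain p q where pq: "p \<in> VS.span (branch m u)" "q \<in> VS.span (branch m w)" "y = p + q"
            using X y unfolding W_eq VS.span_Un by blast
          have "casimir rho m p = scale (ev m ?t) p" "casimir rho m q = scale (ev m ?s) q"
            using pq span_branch_iff span_branch_subset uB wB mn by blast+
          then have "casimir rho m y - scale (ev m ?t) y = scale (ev m ?s - ev m ?t) q"
            by (simp add: pq(3) module_hom.add[OF casimir_linear] VS.scale_left_diff_distrib
                VS.scale_right_distrib)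
          moreover have "casimir rho m y - scale (ev m ?t) y \<in> X"
            using casimir_mem[OF Xm y] subX y by (intro VS.subspace_diff VS.subspace_scale)
          ultimately have "scale (inverse (ev m ?s - ev m ?t)) (scale (ev m ?s - ev m ?t) q) \<in> X"
            using subX VS.subspace_scale by metis
          then have "q \<in> X" using ev_ne by simp
          then have "q = 0" using dichotomy[OF wB] w(2) pq(2) by blast
          then show ?thesis using pq by simp
        qed
        show ?thesis
        proof (rule ccontr)
          assume neg: "\<not> ?thesis"
          then obtain x where x: "x \<in> X" "x \<noteq> 0" using VS.subspace_0[OF subX] by blast
          have "2 * ev (Suc m) ?r = of_nat (Suc m) * (ev (Suc m) ?r - ev m ?t + 1)"
          proof (rule scalar_casimirs[OF _ XB mn(3) x])
            show "casimir rho m y = scale (ev m ?t) y" if "y \<in> X" for y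
              using parts[OF that] span_branch_iff span_branch_subset uB mn by blast
            show "casimir rho (Suc m) y = scale (ev (Suc m) ?r) y" if "y \<in> X" for y
              using that X XB span_branch_iff[of y v "Suc m"] Suc.prems(1) mn by blast
          qed (use X in blast)
          \<comment> \<open>In the first case \<open>ev_Suc_same\<close> gives ?t = 0, which is not
            a successor of ?s. In the second, ?s is the successor of ?t and its bound contradicts
            \<open>ev_Suc_step\<close>.\<close>
          moreover have "?t = ?r \<and> Suc ?s = ?r \<or> Suc ?t = ?r \<and> ?s = ?r"
            using labs[OF u(1)] labs[OF w(1)] u(2) by auto
          moreover have "2 * ?s \<le> m" "2 * ?t \<le> m"
            using lab_bound uB wB mn by auto
          ultimately show False
            using ev_Suc_same[of m ?t] ev_Suc_step[of m ?t] by auto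
        qed
      qed
    qed
  qed
qed

section \<open>The tower of canonical decompositions\<close>

lemma not_isomorphic_span_branch:
  assumes "v \<in> B" "w \<in> B" "m \<le> n" "lab v m \<noteq> lab w m"
  shows "\<not> isomorphic_modules rho (Sym m) (VS.span (branch m v)) (VS.span (branch m w))"
proof
  let ?X = "VS.span (branch m v)" and ?Y = "VS.span (branch m w)"
  assume "isomorphic_modules rho (Sym m) ?X ?Y"
  then obtain f where f: "bij_betw f ?X ?Y"
    and add: "\<And>x y. x \<in> ?X \<Longrightarrow> y \<in> ?X \<Longrightarrow> f (x + y) = f x + f y"
    and scl: "\<And>c x. x \<in> ?X \<Longrightarrow> f (scale c x) = scale c (f x)"
    and eqv: "\<And>\<sigma> x. \<sigma> \<in> Sym m \<Longrightarrow> x \<in> ?X \<Longrightarrow> f (rho \<sigma> x) = rho \<sigma> (f x)"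
    unfolding isomorphic_modules_def by blast
  have subm: "submodule rho (Sym m) ?X"
    using submodule_span_branch[OF assms(1), of m] assms by (simp add: min_absorb1)
  have f0: "f 0 = 0" using scl[OF VS.span_zero, of 0] by simp
  \<comment> \<open>The map f is additive only on ?X, so every summand has to be kept inside
    ?X.\<close>
  have fsum: "f (\<Sum>i\<in>I. g i) = (\<Sum>i\<in>I. f (g i))" if "\<And>i. i \<in> I \<Longrightarrow> g i \<in> ?X" for I :: "nat set" and g
    using that by (induction I rule: infinite_finite_induct) (auto simp: f0 add VS.span_sum)
  have v: "v \<in> ?X" using VS.span_base branch_self assms by blast
  have mem: "rho (Transposition.transpose i j) v \<in> ?X" if "i < m" "j < m" for i j
    using subm v that by (auto simp: submodule_def Sym_def transpose_permutes)
  \<comment> \<open>Equivariance makes f commute with the transposition sum, so the nonzero vector f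
    v would carry the eigenvalues of both modules.\<close>
  have "f (casimir rho m v) = casimir rho m (f v)"
  proof -
    have "f (casimir rho m v) = (\<Sum>i<m. f (\<Sum>j<m. rho (Transposition.transpose i j) v))"
      unfolding casimir_def transposition_row_def by (rule fsum) (auto intro!: VS.span_sum mem)
    also have "\<dots> = (\<Sum>i<m. \<Sum>j<m. f (rho (Transposition.transpose i j) v))"
      by (intro sum.cong refl fsum mem) auto
    also have "\<dots> = casimir rho m (f v)"
      unfolding casimir_def transposition_row_def
      by (intro sum.cong refl eqv v) (auto simp: Sym_def transpose_permutes)
    finally show ?thesis .
  qed
  moreover have "f (casimir rho m v) = scale (ev m (lab v m)) (f v)"
    using assms eigen scl[OF v] by simp
  moreover have fv: "f v \<in> ?Y" using f v bij_betwE by blast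
  then have "casimir rho m (f v) = scale (ev m (lab w m)) (f v)"
    using assms span_branch_iff[of "f v" w m] span_branch_subset by blast
  ultimately have "scale (ev m (lab v m)) (f v) = scale (ev m (lab w m)) (f v)" by simp
  moreover have "f v \<noteq> 0"
    using f0 f v basis_nonzero[OF assms(1)] VS.span_zero
    by (metis bij_betw_imp_inj_on inj_on_eq_iff)
  ultimately have "ev m (lab v m) = ev m (lab w m)"
    by (simp only: VS.scale_cancel_right simp_thms)
  then show False
    using assms ev_inj lab_bound by blast
qed

text \<open>The summands are separated by the label at m: distinct labels exclude isomorphisms, and
  disjoint parts of the independent set B make the sum direct.\<close>

lemma canonical_decomposition_branch:
  assumes "v \<in> B" "m \<le> n"
  shows "canonical_decomposition rho (Sym m) (VS.span (branch (Suc m) v))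
    ((\<lambda>w. VS.span (branch m w)) ` branch (Suc m) v)" (is "canonical_decomposition _ _ ?W ?D")
proof -
  have lab_ne: "lab w m \<noteq> lab u m"
    if "w \<in> branch (Suc m) v" "u \<in> branch (Suc m) v"
      "VS.span (branch m w) \<noteq> VS.span (branch m u)" for u w
  proof
    assume "lab w m = lab u m"
    then have "w \<in> branch m u"
      using that(1,2) by (auto simp: branch_def) (metis le_antisym not_less_eq_eq)
    then show False using branch_eq that(3) by metis
  qed
  have "VS.span (\<Union>?D) = ?W"
  proof (rule VS.span_subspace)
    show "\<Union>?D \<subseteq> ?W" using VS.span_mono[OF branch_trans] by (intro Union_least) auto
    have "branch (Suc m) v \<subseteq> \<Union>?D"
    proof
      fix w assume "w \<in> branch (Suc m) v"
      moreover from this have "w \<in> VS.span (branch m w)"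
        using VS.span_base[OF branch_self] branch_subset by blast
      ultimately show "w \<in> \<Union>?D" by blast
    qed
    then show "?W \<subseteq> VS.span (\<Union>?D)" by (rule VS.span_mono)
  qed simp
  moreover have "X \<inter> VS.span (\<Union>(?D - {X})) = {0}" if "X \<in> ?D" for X
  proof -
    obtain w where w: "w \<in> branch (Suc m) v" "X = VS.span (branch m w)"
      using \<open>X \<in> ?D\<close> by blast
    let ?S = "branch (Suc m) v - branch m w"
    have S: "VS.span (branch m u) \<subseteq> VS.span ?S"
      if "u \<in> branch (Suc m) v" "VS.span (branch m u) \<noteq> X" for u
    proof (rule VS.span_mono)
      have "branch m u \<inter> branch m w = {}"
      proof (rule equals0I)
        fix z assume "z \<in> branch m u \<inter> branch m w"
        then have "branch m z = branch m u" "branch m z = branch m w"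
          by (auto dest: branch_eq)
        then show False using that(2) w(2) by simp
      qed
      then show "branch m u \<subseteq> ?S" using branch_trans[OF that(1)] by blast
    qed
    have "VS.span (\<Union>(?D - {X})) \<subseteq> VS.span ?S"
      by (rule VS.span_minimal) (use S in auto)
    moreover have "y = 0" if "y \<in> VS.span (branch m w)" "y \<in> VS.span ?S" for y
      by (rule independent_span_Int[OF independent_basis _ _ _ that]) (use branch_subset in auto)
    ultimately show ?thesis unfolding w(2) using VS.span_zero by blast
  qed
  moreover have "irreducible_module rho (Sym m) X" if "X \<in> ?D" for X
    using that irreducible_span_branch assms branch_subset by blast
  moreover have "\<not> isomorphic_modules rho (Sym m) X Y" if "X \<in> ?D" "Y \<in> ?D" "X \<noteq> Y" for X Y
    using that lab_ne not_isomorphic_span_branch assms branch_subset by blast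
  ultimately show ?thesis
    unfolding canonical_decomposition_def internal_direct_sum_def
    by (intro conjI ballI impI) assumption+
qed

text \<open>The index shift reflects that labels from \<open>Suc m\<close> on are fixed before
  decomposing over \<open>Sym m\<close>. At m = 0 the branch has been reduced to a single
  vector.\<close>

lemma gz_decomposition_branch:
  assumes "v \<in> B" "m \<le> n"
  shows "gz_decomposition rho m (VS.span (branch (Suc m) v))
    ((\<lambda>w. VS.span {w}) ` branch (Suc m) v)"
  using assms
proof (induction m arbitrary: v)
  case 0
  then show ?case by (simp add: branch_1)
next
  case (Suc m)
  let ?D = "(\<lambda>w. VS.span (branch (Suc m) w)) ` branch (Suc (Suc m)) v"
  \<comment> \<open>The lines must depend on the subspace alone, so they are read off from the basis
    vectors inside X and not from a representative w.\<close>
  let ?f = "\<lambda>X. (\<lambda>w. VS.span {w}) ` (B \<inter> X)"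
  have f: "?f (VS.span (branch (Suc m) w)) = (\<lambda>w. VS.span {w}) ` branch (Suc m) w" if "w \<in> B" for w
    using basis_in_span_branch[OF that] branch_subset by blast
  have "gz_decomposition rho m X (?f X)" if "X \<in> ?D" for X
  proof -
    obtain w where w: "w \<in> branch (Suc (Suc m)) v" "X = VS.span (branch (Suc m) w)"
      using \<open>X \<in> ?D\<close> by blast
    then have wB: "w \<in> B" using branch_subset by blast
    show ?thesis
      unfolding w(2) f[OF wB] by (rule Suc.IH[OF wB]) (use Suc.prems in simp)
  qed
  moreover have "(\<lambda>w. VS.span {w}) ` branch (Suc (Suc m)) v = (\<Union>X\<in>?D. ?f X)"
  proof -
    have "(\<Union>X\<in>?D. ?f X) = (\<Union>w\<in>branch (Suc (Suc m)) v. (\<lambda>w. VS.span {w}) ` branch (Suc m) w)"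
      using f branch_subset by (simp add: subset_iff)
    also have "\<dots> = (\<lambda>w. VS.span {w}) ` (\<Union>w\<in>branch (Suc (Suc m)) v. branch (Suc m) w)"
      by (simp add: image_UN)
    also have "(\<Union>w\<in>branch (Suc (Suc m)) v. branch (Suc m) w) = branch (Suc (Suc m)) v"
    proof
      show "(\<Union>w\<in>branch (Suc (Suc m)) v. branch (Suc m) w) \<subseteq> branch (Suc (Suc m)) v"
        using branch_trans by (rule UN_least)
      show "branch (Suc (Suc m)) v \<subseteq> (\<Union>w\<in>branch (Suc (Suc m)) v. branch (Suc m) w)"
        by (rule subsetI, rule UN_I) (auto intro: branch_self[OF subsetD[OF branch_subset]])
    qed
    finally show ?thesis ..
  qed
  ultimately show ?case
    unfolding gz_decomposition.simps
    by (intro exI[of _ ?D] exI[of _ ?f] conjI ballI canonical_decomposition_branch[OF Suc.prems])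
qed

lemma gz_basis_eigenbasis:
  assumes "B \<noteq> {}"
  shows "gz_basis rho n (VS.span B) B"
proof -
  obtain v where "v \<in> B" using assms by blast
  then have dec: "gz_decomposition rho n (VS.span B) ((\<lambda>w. VS.span {w}) ` B)"
    using gz_decomposition_branch[of v n] by (simp add: branch_top)
  have inj: "w = u" if "u \<in> B" "w \<in> B" "w \<in> VS.span {u}" for u w
    using basis_in_span_branch[of u w 0] that by (simp add: branch_0)
  \<comment> \<open>Recovers from a line the basis vector spanning it, which is unique by
    \<open>inj\<close>.\<close>
  let ?b = "\<lambda>X. SOME w. w \<in> B \<and> X = VS.span {w}"
  have b: "?b (VS.span {w}) = w" if "w \<in> B" for w
  proof (rule some_equality)
    show "u = w" if "u \<in> B \<and> VS.span {w} = VS.span {u}" for u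
      using inj[of w u] that \<open>w \<in> B\<close> VS.span_base[of u "{u}"] by auto
  qed (use that in simp)
  then have "\<forall>X\<in>(\<lambda>w. VS.span {w}) ` B. ?b X \<in> X \<and> ?b X \<noteq> 0"
    using basis_nonzero by (auto intro: VS.span_base)
  moreover have "B = ?b ` (\<lambda>w. VS.span {w}) ` B"
    using b by (simp add: image_image)
  ultimately show ?thesis
    unfolding gz_basis_def by (intro exI[of _ "(\<lambda>w. VS.span {w}) ` B"] exI[of _ ?b] conjI dec)
qed

end

section \<open>The chains of the linear BTK algorithm on the Boolean algebra\<close>

text \<open>
  A chain of O(n) is determined by its history: r m is the rank at which its ancestor in O(m)
  starts, so that this ancestor ends in rank m - r m.
\<close>

definition history :: "nat \<Rightarrow> (nat \<Rightarrow> nat) \<Rightarrow> bool" where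
  "history n r \<longleftrightarrow> r 0 = 0 \<and> (\<forall>m<n. r (Suc m) = r m \<or> r (Suc m) = Suc (r m)) \<and>
     (\<forall>m\<le>n. 2 * r m \<le> m)"

text \<open>A closed form of the algorithm with second factor of length 1. The first case is the
  long chain, with binomial coefficients 1 and i; the second is the image of the short chain under
  \<open>theta\<close>, with p = n - 2 r n. At i = 0 the truncated index i - 1 is harmless, as its
  coefficient is 0.\<close>

primrec chain_vec :: "(nat \<Rightarrow> nat) \<Rightarrow> nat \<Rightarrow> nat \<Rightarrow> (nat list \<Rightarrow>\<^sub>0 complex)" where
  "chain_vec r 0 = (\<lambda>i. if i = 0 then bvec [] else 0)"
| "chain_vec r (Suc n) = (\<lambda>i. if r (Suc n) = r n
     then append_coord 0 (chain_vec r n i) + scale (of_nat i) (append_coord 1 (chain_vec r n (i - 1)))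
     else scale (of_nat n - 2 * of_nat (r n) - of_nat i) (append_coord 1 (chain_vec r n i))
       - append_coord 0 (chain_vec r n (Suc i)))"

section \<open>Length and rank of the chains\<close>

lemma history_Suc:
  "history (Suc n) r \<longleftrightarrow> history n r \<and> (r (Suc n) = r n \<or> r (Suc n) = Suc (r n)) \<and> 2 * r (Suc n) \<le> Suc n"
  by (auto simp: history_def less_Suc_eq le_Suc_eq)

lemma history_bound: "history n r \<Longrightarrow> 2 * r n \<le> n"
  by (simp add: history_def)

lemma history_cong:
  "(\<And>m. m \<le> n \<Longrightarrow> r m = s m) \<Longrightarrow> history n r \<longleftrightarrow> history n s"
  by (induction n) (auto simp: history_Suc history_def)

lemma chain_vec_cong: "(\<And>m. m \<le> n \<Longrightarrow> r m = s m) \<Longrightarrow> chain_vec r n = chain_vec s n"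
  by (induction n) auto

lemma chain_vec_zero:
  "\<lbrakk>history n r; i > n - 2 * r n\<rbrakk> \<Longrightarrow> chain_vec r n i = 0"
proof (induction n arbitrary: i)
  case (Suc n)
  have h: "history n r" and r: "r (Suc n) = r n \<or> r (Suc n) = Suc (r n)"
    and le: "2 * r (Suc n) \<le> Suc n"
    using Suc.prems(1) by (auto simp: history_Suc)
  have b: "2 * r n \<le> n" by (rule history_bound[OF h])
  show ?case
  proof (cases "r (Suc n) = r n")
    case True
    then show ?thesis using Suc.IH[OF h] Suc.prems(2) b by (simp add: append_zero)
  next
    case False
    then have r: "r (Suc n) = Suc (r n)" using r by simp
    then have "n - 2 * r n < Suc i" using Suc.prems(2) b le by simp
    then have "chain_vec r n (Suc i) = 0" by (rule Suc.IH[OF h])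
    \<comment> \<open>At the last position of the old chain the scalar factor vanishes; beyond it
      the vector does.\<close>
    moreover have "scale (of_nat n - 2 * of_nat (r n) - of_nat i) (append_coord 1 (chain_vec r n i)) = 0"
    proof (cases "i = n - 2 * r n")
      case True
      then have "of_nat n - 2 * of_nat (r n) - of_nat i = (0 :: complex)"
        using b by (simp add: of_nat_diff)
      then show ?thesis by simp
    next
      case False
      then have "n - 2 * r n < i" using r Suc.prems(2) le by simp
      then show ?thesis using Suc.IH[OF h] by (simp add: append_zero)
    qed
    ultimately show ?thesis using False by (simp add: append_zero)
  qed
qed auto

lemma chain_vec_level:
  "history n r \<Longrightarrow> chain_vec r n i \<in> vspace (level (Bool_alg n) sum_list (r n + i))"
proof (induction n arbitrary: i)
  case 0
  then show ?case by (auto simp: Bool_alg_0 level_def history_def vspace_zero)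
next
  case (Suc n)
  then have h: "history n r" and r: "r (Suc n) = r n \<or> r (Suc n) = Suc (r n)"
    by (auto simp: history_Suc)
  have IH: "append_coord c (chain_vec r n i) \<in> vspace (level (Bool_alg (Suc n)) sum_list (r n + i + c))"
    if "c \<le> 1" for c i
    by (rule append_level[OF Suc.IH[OF h] that])
  show ?case
  proof (cases "r (Suc n) = r n")
    case True
    have "scale (of_nat i) (append_coord 1 (chain_vec r n (i - 1))) \<in>
        vspace (level (Bool_alg (Suc n)) sum_list (r n + i))"
      using IH[of 1 "i - 1"] by (cases i) (auto intro: vspace_scale simp: vspace_zero)
    then show ?thesis
      using True IH[of 0 i] by (simp add: vspace_add)
  next
    case False
    then show ?thesis
      using r IH[of 1 i] IH[of 0 "Suc i"] by (simp add: vspace_diff vspace_scale)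
  qed
qed

lemma level_subset: "level P rk k \<subseteq> P"
  by (auto simp: level_def)

lemma chain_vec_Bool_alg: "history n r \<Longrightarrow> chain_vec r n i \<in> vspace (Bool_alg n)"
  using chain_vec_level vspace_mono[OF level_subset] by blast

section \<open>Up, down and transposition sums on chain vectors\<close>

lemmas coord_simps = lookup_scale lookup_add lookup_minus

lemma up_chain_vec:
  "history n r \<Longrightarrow> flip n 0 1 (chain_vec r n i) = chain_vec r n (Suc i)"
proof (induction n arbitrary: i)
  case (Suc n)
  then have h: "history n r" by (simp add: history_Suc)
  note rules = flip_add flip_diff flip_scale flip_append[OF chain_vec_Bool_alg[OF h]] Suc.IH[OF h]
  show ?case
    by (rule poly_mapping_eqI, cases i)
      (auto simp: rules coord_simps algebra_simps simp del: One_nat_def)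
qed (auto simp: flip_zero)

text \<open>With l = n - 2 r n the factor is i (l - i + 1), the usual lowering coefficient of an
  sl(2)-string of dimension l + 1.\<close>

lemma down_chain_vec:
  "history n r \<Longrightarrow> flip n 1 0 (chain_vec r n i) =
    scale (of_nat i * (of_nat n - 2 * of_nat (r n) - of_nat i + 1)) (chain_vec r n (i - 1))"
proof (induction n arbitrary: i)
  case (Suc n)
  then have h: "history n r" and r: "r (Suc n) = r n \<or> r (Suc n) = Suc (r n)"
    by (auto simp: history_Suc)
  note rules = flip_add flip_diff flip_scale flip_append[OF chain_vec_Bool_alg[OF h]] Suc.IH[OF h]
  show ?case
  proof (rule poly_mapping_eqI)
    fix x
    \<comment> \<open>Lowering inside the recursion reaches index i - 2, so both truncated
      subtractions need their own case.\<close>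
    consider "i = 0" | "i = Suc 0" | j where "i = Suc (Suc j)" by (metis not0_implies_Suc)
    then show "Poly_Mapping.lookup (flip (Suc n) 1 0 (chain_vec r (Suc n) i)) x =
      Poly_Mapping.lookup (scale (of_nat i * (of_nat (Suc n) - 2 * of_nat (r (Suc n)) - of_nat i + 1))
        (chain_vec r (Suc n) (i - 1))) x"
      by cases (use r in \<open>auto simp: rules coord_simps append_add append_diff append_scale append_zero algebra_simps
        simp del: One_nat_def\<close>)
  qed
qed (auto simp: flip_zero history_def)

text \<open>The scalar is the content of the added box: n - r n at the end of the first row, r n - 1
  at the end of the second. \<open>transposition_row_append\<close> reduces the claim to the up and
  down formulas.\<close>

lemma row_chain_vec:
  assumes "history (Suc n) r"
  shows "transposition_row subst_action n n (chain_vec r (Suc n) i) =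
    scale (if r (Suc n) = r n then of_nat n - of_nat (r n) else of_nat (r n) - 1) (chain_vec r (Suc n) i)"
proof -
  have h: "history n r" and r: "r (Suc n) = r n \<or> r (Suc n) = Suc (r n)"
    using assms by (auto simp: history_Suc)
  have add: "transposition_row subst_action n n (v + w) =
      transposition_row subst_action n n v + transposition_row subst_action n n w"
    and scl: "transposition_row subst_action n n (scale c v) =
      scale c (transposition_row subst_action n n v)"
    and diff: "transposition_row subst_action n n (v - w) =
      transposition_row subst_action n n v - transposition_row subst_action n n w" for v w c
    by (simp_all add: transposition_row_def subst_action_add subst_action_scale subst_action_diff
        sum.distrib sum_subtractf VS.scale_sum_right)
  note rules = add scl diff transposition_row_append[OF chain_vec_level[OF h]]
    up_chain_vec[OF h] down_chain_vec[OF h]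
  show ?thesis
    by (rule poly_mapping_eqI, cases i)
      (use r in \<open>auto simp: rules coord_simps append_add append_diff append_scale append_zero algebra_simps
        simp del: One_nat_def\<close>)
qed

text \<open>Lower levels are inherited through \<open>casimir_append\<close>. At the top level
  \<open>casimir_Suc\<close> adds twice the content of the new box plus 1, the increment of
  \<open>ev\<close>.\<close>

lemma casimir_chain_vec:
  "\<lbrakk>history n r; m \<le> n\<rbrakk> \<Longrightarrow> casimir subst_action m (chain_vec r n i) =
    scale (ev m (r m)) (chain_vec r n i)"
proof (induction n arbitrary: i m)
  case 0
  then show ?case by (simp add: casimir_def history_def ev_def)
next
  case (Suc n)
  then have h: "history n r" and r: "r (Suc n) = r n \<or> r (Suc n) = Suc (r n)"
    by (auto simp: history_Suc)
  have lin: "linear_op (casimir subst_action m)" for m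
    by (rule linear_op_casimir[OF linear_op_subst_action])
  have below: "casimir subst_action m (chain_vec r (Suc n) i) =
      scale (ev m (r m)) (chain_vec r (Suc n) i)"
    if "m \<le> n" for m
    using casimir_append[OF that chain_vec_Bool_alg[OF h]] Suc.IH[OF h that]
    by (simp add: module_hom.add[OF lin] module_hom.diff[OF lin] module_hom.scale[OF lin]
        append_scale VS.scale_right_distrib VS.scale_right_diff_distrib mult.commute)
  show ?case
  proof (cases "m = Suc n")
    case False
    then show ?thesis using below Suc.prems by simp
  next
    case True
    show ?thesis
      unfolding True casimir_Suc[of subst_action, OF subst_action_id] row_chain_vec[OF Suc.prems(1)]
        below[OF order_refl]
      by (rule poly_mapping_eqI)
        (use r in \<open>auto simp: coord_simps ev_def power2_eq_square algebra_simps\<close>)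
  qed
qed

section \<open>The chains computed by the algorithm\<close>

definition chain :: "(nat \<Rightarrow> nat) \<Rightarrow> nat \<Rightarrow> (nat list \<Rightarrow>\<^sub>0 complex) list" where
  "chain r n = map (chain_vec r n) [0..<Suc (n - 2 * r n)]"

lemma psi_simps:
  "psi vs (v + w) = psi vs v + psi vs w" "psi vs (v - w) = psi vs v - psi vs w"
  "psi vs (scale c v) = scale c (psi vs v)" "psi vs 0 = 0"
  "psi vs (bvec [i, j]) = append_coord j (vs ! i)"
  by (simp_all add: psi_def lin_add lin_scale lin_diff lin_zero)

lemma vsum_1:
  assumes "k \<le> Suc p"
  shows "vsum p 1 k =
    (if k \<le> p then bvec [k, 0] else 0) + scale (of_nat k) (bvec [k - 1, 1])"
proof (cases k)
  case 0
  have "{(i, j). i \<le> p \<and> j \<le> 1 \<and> i + j = k} = {(0, 0)}" using 0 by auto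
  then show ?thesis unfolding vsum_def using 0 by simp
next
  case (Suc k')
  have "{(i, j). i \<le> p \<and> j \<le> 1 \<and> i + j = k} = (if k \<le> p then {(k, 0)} else {}) \<union> {(k', 1)}"
    using Suc assms by (auto simp: le_Suc_eq)
  then show ?thesis unfolding vsum_def using Suc by (simp add: binomial_Suc_n)
qed

lemma btk2_0_right: "btk2 p 0 = [map (\<lambda>i. bvec [i, 0]) [0..<Suc p]]"
  by (cases p) auto

text \<open>One step turns a chain into the two chains that extend its history. A chain consisting
  of one vector has only the long extension, because \<open>btk2 0 1\<close> has no recursive
  part.\<close>

lemma btk2_chain:
  assumes "history n r"
  shows "map (map (psi (chain r n))) (btk2 (length (chain r n) - 1) 1) =
    chain (r(Suc n := r n)) (Suc n) #
      (if 2 * r n = n then [] else [chain (r(Suc n := Suc (r n))) (Suc n)])"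
proof -
  let ?l = "n - 2 * r n"
  have b: "2 * r n \<le> n" by (rule history_bound[OF assms])
  have nth: "chain r n ! i = chain_vec r n i" if "i \<le> ?l" for i
    using that by (simp add: chain_def nth_append del: upt_Suc)
  have cong: "chain_vec (r(Suc n := a)) n = chain_vec r n" for a
    by (rule chain_vec_cong) auto
  have len: "length (chain r n) - 1 = ?l" by (simp add: chain_def)
  show ?thesis
  proof (cases ?l)
    case 0
    then have n: "2 * r n = n" using b by simp
    then have "chain_vec r n (Suc 0) = 0" using chain_vec_zero[OF assms, of "Suc 0"] by simp
    then show ?thesis
      unfolding len 0
      using n nth[of 0] by (simp add: chain_def[of _ "Suc n"] psi_simps cong append_zero)
  next
    case (Suc p)
    have l: "of_nat n - 2 * of_nat (r n) = (of_nat (Suc p) :: complex)"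
      using Suc b by (metis of_nat_diff of_nat_mult of_nat_numeral)
    have first: "psi (chain r n) (vsum (Suc p) 1 k) = chain_vec (r(Suc n := r n)) (Suc n) k"
      if "k \<le> Suc (Suc p)" for k
    proof -
      \<comment> \<open>At k = p + 2 the grid has no element (k, 0); correspondingly
        \<open>chain_vec r n k\<close> is zero past the end of the chain.\<close>
      have "psi (chain r n) (if k \<le> Suc p then bvec [k, 0] else 0) = append_coord 0 (chain_vec r n k)"
        using nth[of k] chain_vec_zero[OF assms, of k] Suc by (simp add: psi_simps append_zero)
      moreover have "psi (chain r n) (bvec [k - 1, 1]) = append_coord 1 (chain_vec r n (k - 1))"
        using nth[of "k - 1"] Suc that by (simp add: psi_simps)
      ultimately show ?thesis
        unfolding vsum_1[OF that] psi_simps(1,3) by (simp add: cong)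
    qed
    have second: "psi (chain r n) (theta (Suc p) 1 (bvec [k, 0])) =
        chain_vec (r(Suc n := Suc (r n))) (Suc n) k" if "k \<le> p" for k
    proof -
      have "theta (Suc p) 1 (bvec [k, 0]) =
          scale (of_nat (Suc p) - of_nat k) (bvec [k, 1]) - bvec [Suc k, 0]"
        by (simp add: theta_def vdiff_def)
      then show ?thesis
        using nth[of k] nth[of "Suc k"] Suc that by (simp only: psi_simps) (simp add: cong l)
    qed
    have "n \<noteq> 2 * r n" using Suc by simp
    have eq: "btk2 ?l 1 = [map (vsum (Suc p) 1) [0..<Suc (Suc (Suc p))],
        map (theta (Suc p) 1) (map (\<lambda>i. bvec [i, 0]) [0..<Suc p])]"
      unfolding Suc One_nat_def btk2.simps btk2_0_right by (simp del: upt_Suc)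
    have "Suc n - 2 * r n = Suc (Suc p)" "Suc n - 2 * Suc (r n) = p"
      using Suc b by auto
    then show ?thesis
      unfolding len eq using first second \<open>n \<noteq> 2 * r n\<close>
      by (simp add: chain_def[of _ "Suc n"] less_Suc_eq_le del: upt_Suc chain_vec.simps)
  qed
qed

lemma btk_Suc:
  assumes "n \<ge> 1"
  shows "btk_Bool_alg (Suc n) =
    concat (map (\<lambda>vs. map (map (psi vs)) (btk2 (length vs - 1) 1)) (btk_Bool_alg n))"
proof -
  obtain k where k: "n = Suc k" using assms by (cases n) auto
  have r: "replicate (Suc n) (1 :: nat) = 1 # 1 # replicate k 1" using k by simp
  have "butlast (1 # 1 # replicate k 1) = replicate n (1 :: nat)"
    using k r by (metis butlast_snoc replicate_Suc replicate_append_same)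
  moreover have "last (1 # replicate k 1) = (1 :: nat)"
    by (cases k) auto
  ultimately show ?thesis
    unfolding btk_Bool_alg_def r btk.simps by simp
qed

lemma btk_1: "btk_Bool_alg 1 = [chain (\<lambda>_. 0) 1]"
  by (simp add: btk_Bool_alg_def chain_def append_zero)

lemma btk_history:
  assumes "n \<ge> 1" "vs \<in> set (btk_Bool_alg n)"
  shows "\<exists>r. history n r \<and> vs = chain r n"
  using assms
proof (induction n arbitrary: vs rule: dec_induct)
  case base
  then show ?case
    by (auto simp: btk_1[simplified] history_def intro!: exI[of _ "\<lambda>_. 0"])
next
  case (step n)
  then obtain us where us: "us \<in> set (btk_Bool_alg n)"
    "vs \<in> set (map (map (psi us)) (btk2 (length us - 1) 1))"
    by (auto simp: btk_Suc)
  obtain r where r: "history n r" "us = chain r n" using step.IH[OF us(1)] by blast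
  have "history n (r(Suc n := a))" for a
    using r(1) history_cong[of n "r(Suc n := a)" r] by simp
  then have "history (Suc n) (r(Suc n := r n))"
    "2 * r n \<noteq> n \<Longrightarrow> history (Suc n) (r(Suc n := Suc (r n)))"
    using history_bound[OF r(1)] by (auto simp: history_Suc)
  then show ?case
    using us(2) unfolding r(2) btk2_chain[OF r(1)] by (auto split: if_splits)
qed

section \<open>Counting and spanning\<close>

lemma length_concat_concat:
  assumes "\<And>x. x \<in> set xs \<Longrightarrow> length (concat (f x)) = c * length x"
  shows "length (concat (concat (map f xs))) = c * length (concat xs)"
  using assms by (induction xs) (auto simp: algebra_simps)

text \<open>A chain with l + 1 vectors gives chains with l + 2 and l vectors, the latter absent for
  l = 0, so the total doubles.\<close>

lemma length_btk:
  assumes "n \<ge> 1"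
  shows "length (concat (btk_Bool_alg n)) = 2 ^ n"
  using assms
proof (induction n rule: dec_induct)
  case base
  then show ?case by (simp add: btk_1[simplified] chain_def)
next
  case (step n)
  have "length (concat (map (map (psi vs)) (btk2 (length vs - 1) 1))) = 2 * length vs"
    if vs: "vs \<in> set (btk_Bool_alg n)" for vs
  proof -
    obtain r where r: "history n r" "vs = chain r n" using btk_history step.hyps(1) vs by blast
    show ?thesis
      unfolding r(2) btk2_chain[OF r(1)]
      using history_bound[OF r(1)] by (auto simp: chain_def simp del: upt_Suc)
  qed
  from length_concat_concat[where c = 2, OF this] step show ?case by (simp add: btk_Suc)
qed

text \<open>The recursion for the two extended chains can be solved for the appended vectors, since
  its determinant l + 1 is nonzero.\<close>

lemma append_coord_in_span_btk:
  assumes n: "n \<ge> 1" and v: "v \<in> set (concat (btk_Bool_alg n))" and "c \<le> 1"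
  shows "append_coord c v \<in> VS.span (set (concat (btk_Bool_alg (Suc n))))" (is "_ \<in> ?S")
proof -
  obtain vs where vs: "vs \<in> set (btk_Bool_alg n)" "v \<in> set vs" using v by auto
  obtain r where r: "history n r" "vs = chain r n" using btk_history[OF n vs(1)] by blast
  let ?l = "n - 2 * r n"
  let ?r1 = "r(Suc n := r n)" and ?r2 = "r(Suc n := Suc (r n))"
  have b: "2 * r n \<le> n" by (rule history_bound[OF r(1)])
  have l: "of_nat n - 2 * of_nat (r n) = (of_nat ?l :: complex)"
    using b by (simp add: of_nat_diff)
  have cong: "chain_vec (r(Suc n := a)) n = chain_vec r n" for a
    by (rule chain_vec_cong) auto
  have sub: "set (map (map (psi vs)) (btk2 (length vs - 1) 1)) \<subseteq> set (btk_Bool_alg (Suc n))"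
    unfolding btk_Suc[OF n] using vs(1) by auto
  have c1: "chain ?r1 (Suc n) \<in> set (btk_Bool_alg (Suc n))"
    using sub unfolding r(2) btk2_chain[OF r(1)] by simp
  have c2: "chain ?r2 (Suc n) \<in> set (btk_Bool_alg (Suc n))" if "2 * r n \<noteq> n"
    using sub that unfolding r(2) btk2_chain[OF r(1)] by simp
  have V1: "append_coord 0 (chain_vec r n i) + scale (of_nat i) (append_coord 1 (chain_vec r n (i - 1)))
      \<in> ?S" if "i \<le> Suc ?l" for i
  proof -
    have "chain_vec ?r1 (Suc n) i \<in> set (chain ?r1 (Suc n))"
      unfolding chain_def set_map by (rule imageI) (use that b in auto)
    then have "chain_vec ?r1 (Suc n) i \<in> ?S" using c1 by (intro VS.span_base) auto
    then show ?thesis by (simp add: cong)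
  qed
  have V2: "scale (of_nat ?l - of_nat i) (append_coord 1 (chain_vec r n i))
      - append_coord 0 (chain_vec r n (Suc i)) \<in> ?S" if "i \<le> ?l" for i
  \<comment> \<open>For i = l the expression is not an entry of the short chain, but it is
    0.\<close>
  proof (cases "i = ?l")
    case True
    then have "chain_vec r n (Suc i) = 0" by (intro chain_vec_zero[OF r(1)]) simp
    then show ?thesis using True by (simp add: append_zero VS.span_zero)
  next
    case False
    then have "2 * r n \<noteq> n" using that by auto
    moreover have "chain_vec ?r2 (Suc n) i \<in> set (chain ?r2 (Suc n))"
      unfolding chain_def set_map by (rule imageI) (use that False b in auto)
    ultimately have "chain_vec ?r2 (Suc n) i \<in> ?S" using c2 by (intro VS.span_base) auto
    then show ?thesis by (simp add: cong l)
  qed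
  \<comment> \<open>Adding V1 at i + 1 to V2 at i cancels the terms ending in 0 and leaves the
    coefficient (i + 1) + (l - i) = l + 1.\<close>
  have app1: "append_coord 1 (chain_vec r n i) \<in> ?S" if "i \<le> ?l" for i
  proof -
    have "scale (of_nat ?l + 1) (append_coord 1 (chain_vec r n i)) \<in> ?S"
      using VS.span_add[OF V1[of "Suc i"] V2[OF that]] that
      by (simp add: VS.scale_left_distrib VS.scale_left_diff_distrib algebra_simps)
    from VS.span_scale[OF this, of "inverse (of_nat ?l + 1)"] show ?thesis
      by (simp add: add.commute del: of_nat_diff flip: of_nat_Suc)
  qed
  have app0: "append_coord 0 (chain_vec r n i) \<in> ?S" if "i \<le> ?l" for i
  proof -
    have "scale (of_nat i) (append_coord 1 (chain_vec r n (i - 1))) \<in> ?S"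
      using app1[of "i - 1"] that by (intro VS.span_scale) auto
    from VS.span_diff[OF V1[of i] this] that show ?thesis by simp
  qed
  obtain i where "i \<le> ?l" "v = chain_vec r n i"
    using vs(2) unfolding r(2) chain_def set_map set_upt by (auto simp: less_Suc_eq_le)
  moreover have "c = 0 \<or> c = 1" using \<open>c \<le> 1\<close> by auto
  ultimately show ?thesis using app0 app1 by auto
qed

lemma btk_mem:
  assumes "n \<ge> 1" "v \<in> set (concat (btk_Bool_alg n))"
  shows "\<exists>r i. history n r \<and> v = chain_vec r n i"
proof -
  obtain vs where vs: "vs \<in> set (btk_Bool_alg n)" "v \<in> set vs" using assms by auto
  obtain r where r: "history n r" "vs = chain r n" using btk_history[OF assms(1) vs(1)] by blast
  obtain i where "v = chain_vec r n i"
    using vs(2) unfolding r(2) chain_def by (auto simp del: upt_Suc)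
  then show ?thesis using r(1) by blast
qed

lemma span_btk:
  assumes "n \<ge> 1"
  shows "VS.span (set (concat (btk_Bool_alg n))) = vspace (Bool_alg n)"
proof
  show "VS.span (set (concat (btk_Bool_alg n))) \<subseteq> vspace (Bool_alg n)"
    using btk_mem[OF assms] chain_vec_Bool_alg by (intro VS.span_minimal subspace_vspace) blast
  have "bvec ` Bool_alg n \<subseteq> VS.span (set (concat (btk_Bool_alg n)))"
    using assms
  proof (induction n rule: dec_induct)
    case base
    have "bvec ` Bool_alg 1 \<subseteq> set (concat (btk_Bool_alg 1))"
      by (auto simp: btk_1[simplified] chain_def Bool_alg_Suc Bool_alg_0 le_Suc_eq append_zero)
    then show ?case using VS.span_superset by blast
  next
    case (step n)
    have "append_coord c v \<in> VS.span (set (concat (btk_Bool_alg (Suc n))))"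
      if "v \<in> VS.span (set (concat (btk_Bool_alg n)))" "c \<le> 1" for c v
    proof -
      have "append_coord c ` VS.span (set (concat (btk_Bool_alg n))) =
          VS.span (append_coord c ` set (concat (btk_Bool_alg n)))"
        by (rule module_hom.span_image[OF linear_op_append, symmetric])
      also have "\<dots> \<subseteq> VS.span (set (concat (btk_Bool_alg (Suc n))))"
        using append_coord_in_span_btk[OF step.hyps(1) _ that(2)] by (intro VS.span_minimal) auto
      finally show ?thesis using that(1) by blast
    qed
    then have "append_coord c (bvec x) \<in> VS.span (set (concat (btk_Bool_alg (Suc n))))"
      if "x \<in> Bool_alg n" "c \<le> 1" for x c
      using step.IH that by blast
    then show ?case by (auto simp: Bool_alg_Suc)
  qed
  then show "vspace (Bool_alg n) \<subseteq> VS.span (set (concat (btk_Bool_alg n)))"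
    unfolding vspace_eq_span by (intro VS.span_minimal) auto
qed

text \<open>A maximal independent part of the list still spans T, hence has at least
  \<open>card T\<close> elements; by the length bound it exhausts the list, without
  repetitions.\<close>

lemma distinct_independent_of_span:
  assumes "VS.independent T" "finite T" "T \<subseteq> VS.span (set xs)" "length xs \<le> card T"
  shows "distinct xs" "VS.independent (set xs)"
proof -
  obtain S where S: "S \<subseteq> set xs" "VS.independent S" "set xs \<subseteq> VS.span S"
    using VS.maximal_independent_subset by blast
  have fin: "finite S" using S(1) finite_subset by blast
  have "T \<subseteq> VS.span S" using assms(3) S(3) VS.span_mono VS.span_span by blast
  then have "card T \<le> card S" using VS.independent_span_bound[OF fin assms(1)] by simp
  moreover have "card S \<le> card (set xs)" "card (set xs) \<le> length xs"
    using S(1) by (auto intro: card_mono card_length)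
  ultimately have *: "card S = card (set xs)" "card (set xs) = length xs" using assms(4) by auto
  show "distinct xs" using *(2) by (rule card_distinct)
  have "S = set xs" using card_subset_eq[OF _ S(1) *(1)] by simp
  then show "VS.independent (set xs)" using S(2) by simp
qed

lemma btk_basis:
  assumes "n \<ge> 1"
  shows "distinct (concat (btk_Bool_alg n))" "VS.independent (set (concat (btk_Bool_alg n)))"
proof -
  have "card (bvec ` Bool_alg n) = 2 ^ n"
    using card_image[OF inj_on_subset[OF inj_bvec], of "Bool_alg n"] by (simp add: card_Bool_alg)
  then have card: "length (concat (btk_Bool_alg n)) \<le> card (bvec ` Bool_alg n)"
    by (simp only: length_btk[OF assms])
  have sub: "bvec ` Bool_alg n \<subseteq> VS.span (set (concat (btk_Bool_alg n)))"
    unfolding span_btk[OF assms] by auto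
  note * = distinct_independent_of_span[OF independent_bvec finite_imageI[OF finite_Bool_alg] sub card]
  show "distinct (concat (btk_Bool_alg n))" "VS.independent (set (concat (btk_Bool_alg n)))"
    by (fact *)+
qed

lemma symmetric_jordan_basis_btk:
  assumes "n \<ge> 1"
  shows "symmetric_jordan_basis (Bool_alg n) tuple_le sum_list (btk_Bool_alg n)"
  unfolding symmetric_jordan_basis_def
proof (intro conjI ballI btk_basis[OF assms] span_btk[OF assms])
  fix vs assume vs: "vs \<in> set (btk_Bool_alg n)"
  obtain r where r: "history n r" "vs = chain r n" using btk_history[OF assms vs] by blast
  let ?l = "n - 2 * r n"
  have b: "2 * r n \<le> n" by (rule history_bound[OF r(1)])
  have len: "length vs = Suc ?l" by (simp add: r(2) chain_def)
  have nth: "vs ! i = chain_vec r n i" if "i \<le> ?l" for i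
    using that by (simp add: r(2) chain_def del: upt_Suc)
  have ne: "vs \<noteq> []" using len by auto
  have hd: "hd vs = chain_vec r n 0" and last: "last vs = chain_vec r n ?l"
    using nth[of 0] nth[of ?l] ne len by (auto simp: hd_conv_nth last_conv_nth)
  have up: "up (Bool_alg n) tuple_le (chain_vec r n i) = chain_vec r n (Suc i)" for i
    using up_Bool_alg[OF chain_vec_Bool_alg[OF r(1)]] up_chain_vec[OF r(1)] by simp
  have "v \<noteq> 0 \<and> (\<exists>i. v \<in> vspace (level (Bool_alg n) sum_list i))" if "v \<in> set vs" for v
  proof
    \<comment> \<open>That no vector vanishes follows from independence, not from the
      recursion.\<close>
    have "v \<in> set (concat (btk_Bool_alg n))" using vs that by auto
    then show "v \<noteq> 0" using btk_basis(2)[OF assms] VS.dependent_zero by blast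
    obtain i where "v = chain_vec r n i" using \<open>v \<in> set vs\<close> unfolding r(2) chain_def by (auto simp del: upt_Suc)
    then show "\<exists>i. v \<in> vspace (level (Bool_alg n) sum_list i)" using chain_vec_level[OF r(1)] by auto
  qed
  moreover have "up (Bool_alg n) tuple_le (vs ! i) = vs ! Suc i" if "Suc i < length vs" for i
    using that len nth[of i] nth[of "Suc i"] up by simp
  moreover have "up (Bool_alg n) tuple_le (last vs) = 0"
    unfolding last up by (rule chain_vec_zero[OF r(1)]) simp
  moreover have "hd vs \<in> vspace (level (Bool_alg n) sum_list (r n))"
    "last vs \<in> vspace (level (Bool_alg n) sum_list (r n + ?l))"
    unfolding hd last using chain_vec_level[OF r(1), of 0] chain_vec_level[OF r(1), of ?l] by auto
  moreover have "r n + (r n + ?l) = poset_rank (Bool_alg n) sum_list"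
    using b by (simp add: Max_rank_Bool_alg)
  ultimately show "symmetric_jordan_chain (Bool_alg n) tuple_le sum_list vs"
    unfolding symmetric_jordan_chain_def using ne by blast
qed

section \<open>Restriction to one rank\<close>

lemma level_unique:
  assumes "v \<in> vspace (level P rk a)" "v \<in> vspace (level P rk b)" "v \<noteq> 0"
  shows "a = b"
proof -
  obtain x where "x \<in> Poly_Mapping.keys v" using assms(3) by (auto simp flip: keys_eq_empty)
  then show ?thesis using assms(1,2) by (auto simp: vspace_def level_def)
qed

text \<open>The projection onto rank k fixes the generators of that rank and kills the
  others.\<close>

lemma span_homogeneous:
  assumes S: "VS.span S = vspace P" and hom: "\<And>v. v \<in> S \<Longrightarrow> \<exists>i. v \<in> vspace (level P rk i)"
  shows "VS.span {v \<in> S. v \<in> vspace (level P rk k)} = vspace (level P rk k)"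
proof
  let ?T = "{v \<in> S. v \<in> vspace (level P rk k)}"
  let ?\<pi> = "lin (\<lambda>x. if x \<in> level P rk k then bvec x else 0)"
  have keep: "?\<pi> v = v" if "v \<in> vspace (level P rk k)" for v
    by (rule linear_op_eq_on_vspace[OF linear_op_lin _ _ that]) (auto intro: linear_opI)
  have kill: "?\<pi> v = 0" if "v \<in> vspace (level P rk i)" "i \<noteq> k" for v i
    by (rule linear_op_eq_on_vspace[OF linear_op_lin _ _ that(1)])
      (use that(2) in \<open>auto intro: linear_opI simp: level_def\<close>)
  show "VS.span ?T \<subseteq> vspace (level P rk k)"
    using subspace_vspace by (intro VS.span_minimal) auto
  show "vspace (level P rk k) \<subseteq> VS.span ?T"
  proof
    fix v assume v: "v \<in> vspace (level P rk k)"
    then have "v \<in> VS.span S" using S vspace_mono[OF level_subset] by blast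
    then have "?\<pi> v \<in> VS.span (?\<pi> ` S)"
      using module_hom.span_image[OF linear_op_lin] by blast
    also have "VS.span (?\<pi> ` S) \<subseteq> VS.span ?T"
    proof (rule VS.span_minimal)
      have "?\<pi> w \<in> VS.span ?T" if "w \<in> S" for w
      proof -
        obtain i where i: "w \<in> vspace (level P rk i)" using hom[OF \<open>w \<in> S\<close>] by blast
        show ?thesis
          using keep kill i that by (cases "i = k") (auto intro: VS.span_base VS.span_zero)
      qed
      then show "?\<pi> ` S \<subseteq> VS.span ?T" by blast
    qed simp
    finally show "v \<in> VS.span ?T" using keep[OF v] by simp
  qed
qed

lemma gz_basis_btk:
  assumes n: "n \<ge> 1" and k: "k \<le> n"
  shows "gz_basis subst_action n (vspace (level (Bool_alg n) sum_list k))
    {v \<in> set (concat (btk_Bool_alg n)). v \<in> vspace (level (Bool_alg n) sum_list k)}"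
proof -
  let ?V = "vspace (level (Bool_alg n) sum_list k)"
  let ?B = "{v \<in> set (concat (btk_Bool_alg n)). v \<in> ?V}"
  have span: "VS.span ?B = ?V"
    using btk_mem[OF n] chain_vec_level by (intro span_homogeneous span_btk[OF n]) blast
  \<comment> \<open>A vector does not display its history, so a history and then a position are
    chosen for it.\<close>
  define lab where "lab v = (SOME r. \<exists>i. history n r \<and> v = chain_vec r n i)" for v
  define pos where "pos v = (SOME i. v = chain_vec (lab v) n i)" for v
  have ex: "\<exists>i. history n (lab v) \<and> v = chain_vec (lab v) n i" if "v \<in> ?B" for v
    unfolding lab_def
    by (rule someI_ex[of "\<lambda>r. \<exists>i. history n r \<and> v = chain_vec r n i"])
      (use btk_mem[OF n] that in blast)
  have lab: "history n (lab v)" if "v \<in> ?B" for v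
    using ex[OF that] by blast
  have pos: "v = chain_vec (lab v) n (pos v)" if "v \<in> ?B" for v
    unfolding pos_def
    by (rule someI_ex[of "\<lambda>i. v = chain_vec (lab v) n i"]) (use ex[OF that] in blast)
  have indep: "VS.independent ?B"
    by (rule VS.independent_mono[OF btk_basis(2)[OF n]]) auto
  \<comment> \<open>Within rank k the position is determined by the final label, so equal labels
    give equal vectors, as \<open>lab_inj\<close> demands.\<close>
  have rank: "lab v n + pos v = k" if v: "v \<in> ?B" for v
  proof (rule level_unique)
    show "v \<in> ?V" using v by simp
    show "v \<in> vspace (level (Bool_alg n) sum_list (lab v n + pos v))"
      using chain_vec_level[OF lab[OF v], of "pos v"] unfolding pos[OF v, symmetric] .
    show "v \<noteq> 0"
    proof
      assume "v = 0"
      then have "0 \<in> ?B" using v by simp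
      then show False using VS.dependent_zero indep by iprover
    qed
  qed
  interpret gz_eigenbasis subst_action n ?B lab
  proof (rule gz_eigenbasis.intro)
    show "linear_op (subst_action \<sigma>)" for \<sigma> by (rule linear_op_subst_action)
    show "subst_action id v = v" for v by simp
    show "subst_action (\<sigma> \<circ> \<tau>) v = subst_action \<sigma> (subst_action \<tau> v)"
      if "\<sigma> permutes {..<n}" "\<tau> permutes {..<n}" "v \<in> VS.span ?B" for \<sigma> \<tau> v
      using that(3) vspace_mono[OF level_subset] unfolding span
      by (intro subst_action_comp[OF that(1,2)]) blast
    show "subst_action \<sigma> v \<in> VS.span ?B" if "\<sigma> permutes {..<n}" "v \<in> VS.span ?B" for \<sigma> v
      using that(2) subst_action_level[OF that(1)] unfolding span by blast
    show "finite ?B" by simp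
    show "VS.independent ?B" by (rule indep)
    show "casimir subst_action m v = scale (ev m (lab v m)) v"
      if "v \<in> ?B" "m \<le> n" for v m
      using casimir_chain_vec[OF lab[OF that(1)] that(2), of "pos v"]
      unfolding pos[OF that(1), symmetric] .
    show "2 * lab v m \<le> m" if "v \<in> ?B" "m \<le> n" for v m
      using lab[OF that(1)] that(2) by (simp add: history_def)
    show "lab v (Suc m) = lab v m \<or> lab v (Suc m) = Suc (lab v m)" if "v \<in> ?B" "m < n" for v m
      using lab[OF that(1)] that(2) by (simp add: history_def)
    show "v = w" if v: "v \<in> ?B" and w: "w \<in> ?B" and eq: "\<And>m. m \<le> n \<Longrightarrow> lab v m = lab w m" for v w
    proof -
      have "chain_vec (lab v) n = chain_vec (lab w) n" by (rule chain_vec_cong[OF eq])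
      moreover have "pos v = pos w" using rank[OF v] rank[OF w] eq[of n] by simp
      ultimately have "chain_vec (lab v) n (pos v) = chain_vec (lab w) n (pos w)" by simp
      then show ?thesis unfolding pos[OF v, symmetric] pos[OF w, symmetric] .
    qed
  qed
  \<comment> \<open>A tuple with k ones shows that the level is nonzero, which makes the eigenbasis
    nonempty.\<close>
  have "replicate k 1 @ replicate (n - k) 0 \<in> level (Bool_alg n) sum_list k"
    using k by (auto simp: level_def Bool_alg_alt sum_list_replicate)
  then have "?V \<noteq> {0}"
    using bvec_in_vspace by (metis bvec_def singletonD single_zero zero_neq_one lookup_single_eq lookup_zero)
  then have "?B \<noteq> {}" using span VS.span_empty by metis
  from gz_basis_eigenbasis[OF this] show ?thesis unfolding span .
qed

theorem theorem1p3:
  fixes n :: nat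
  assumes "n \<ge> 1"
  shows "symmetric_jordan_basis (Bool_alg n) tuple_le sum_list (btk_Bool_alg n) \<and>
         (\<forall>k\<le>n. gz_basis subst_action n (vspace (level (Bool_alg n) sum_list k))
                   {v \<in> set (concat (btk_Bool_alg n)). v \<in> vspace (level (Bool_alg n) sum_list k)})"
  using assms symmetric_jordan_basis_btk gz_basis_btk by blast

end
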